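(* Let $t\in(0,1)$ and suppose $(Z_1,\dots,Z_p)^T\sim N((\mu_1,\dots,\mu_p)^T,\boldsymbol\Sigma)$ with $\boldsymbol\Sigma=(\sigma_{ij})$ and $\sigma_{jj}=1$ for $j=1,\dots,p$. For any $i,j\in\mathcal H_1$, $i\neq j$, assume that $$|\mu_i|\ge2|z_{t/2}|>2\sqrt{\log(3)/2},\qquad |\sigma_{ij}|\le\frac{|\mu|_{\min}}{|\mu|_{\max}+z_{t/2}},\qquad \mathrm{sign}(\sigma_{ij})=\mathrm{sign}(\mu_i\mu_j),$$ where $|\mu|_{\min}=\min(|\mu_i|,|\mu_j|)$ and $|\mu|_{\max}=\max(|\mu_i|,|\mu_j|)$. Then $V_2(t)>0$, where $$V_2(t)=\frac{2p_1^2\bar\xi^2}{(p_0t+p_1\bar\xi)^4}\sum_{\substack{i<j\\ i,j\in\mathcal H_0}}\mathrm{Cov}(t_i,t_j)-\frac{2p_0p_1t\bar\xi}{(p_0t+p_1\bar\xi)^4}\sum_{\substack{i\in\mathcal H_0\\ j\in\mathcal H_1}}\mathrm{Cov}(t_i,t_j)+\frac{2p_0^2t^2}{(p_0t+p_1\bar\xi)^4}\sum_{\substack{i<j\\ i,j\in\mathcal H_1}}\mathrm{Cov}(t_i,t_j).$$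
   Context: $\Phi$ is the standard normal distribution function and $z_{t/2}=\Phi^{-1}(t/2)$ is the $(t/2)$th quantile (so $z_{t/2}<0$). The hypotheses tested are $H_{0j}:\mu_j=0$ versus $H_{1j}:\mu_j\ne0$, $j=1,\dots,p$. $\mathcal H_0=\{j:\mu_j=0\}$ (true nulls), $\mathcal H_1=\{j:\mu_j\neq0\}$ (false nulls), with cardinalities $p_0,p_1$. The $j$th test is $t_j=\mathbf 1(|Z_j|>|z_{t/2}|)$. $\xi_j=\Phi(z_{t/2}+\mu_j)+\Phi(z_{t/2}-\mu_j)$ and $\bar\xi=\frac1{p_1}\sum_{j\in\mathcal H_1}\xi_j$.
   Formalization: The formal theorem adds the assumptions p_0 ≥ 1 and p_1 ≥ 2; without them the strict inequality fails: V_2(t)=0 if p_0=0 or p_1=0, and also for p_1=1 with Σ the identity matrix. *)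

theory Defs
  imports "HOL-Probability.Probability"
begin

definition std_gaussian :: "(real ^ 'n) measure" where
  "std_gaussian = density lborel (\<lambda>w. ennreal (\<Prod>i\<in>UNIV. std_normal_density (w $ i)))"

text \<open>
  \<open>Z \<sim> N(\<mu>, \<Sigma>)\<close>: \<open>Z\<close> has the law of \<open>\<mu> + A W\<close> for a standard Gaussian vector \<open>W\<close>
  and a matrix \<open>A\<close> with \<open>A A\<^sup>T = \<Sigma>\<close>. No density is required, so \<open>\<Sigma>\<close> may be any
  positive semidefinite matrix, including a singular one; square \<open>A\<close> suffice for this.
\<close>
definition multivariate_normal ::
    "'a measure \<Rightarrow> ('a \<Rightarrow> real ^ 'n) \<Rightarrow> real ^ 'n \<Rightarrow> real ^ 'n ^ 'n \<Rightarrow> bool" where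
  "multivariate_normal M Z \<mu> \<Sigma> \<longleftrightarrow>
     Z \<in> borel_measurable M \<and>
     (\<exists>A :: real ^ 'n ^ 'n. A ** transpose A = \<Sigma> \<and>
        distr M borel Z = distr std_gaussian borel (\<lambda>w. \<mu> + A *v w))"

definition covariance :: "'a measure \<Rightarrow> ('a \<Rightarrow> real) \<Rightarrow> ('a \<Rightarrow> real) \<Rightarrow> real" where
  "covariance M X Y =
     (LINT \<omega>|M. (X \<omega> - (LINT \<omega>'|M. X \<omega>')) * (Y \<omega> - (LINT \<omega>'|M. Y \<omega>')))"

definition \<Phi> :: "real \<Rightarrow> real" where
  "\<Phi> x = cdf std_normal_distribution x"

text \<open>
  \<open>\<Phi>\<close> is injective with range \<open>{0<..<1}\<close>, so \<open>inv \<Phi>\<close> is the quantile function on that interval.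
  Note that \<open>quantile_half t\<close> is the lower quantile, negative for \<open>0 < t < 1\<close>.
\<close>
definition quantile_half :: "real \<Rightarrow> real" where
  "quantile_half t = inv \<Phi> (t / 2)"

definition true_nulls :: "real ^ 'n \<Rightarrow> 'n set" where
  "true_nulls \<mu> = {j. \<mu> $ j = 0}"

definition false_nulls :: "real ^ 'n \<Rightarrow> 'n set" where
  "false_nulls \<mu> = {j. \<mu> $ j \<noteq> 0}"

definition test :: "real \<Rightarrow> ('a \<Rightarrow> real ^ 'n) \<Rightarrow> 'n \<Rightarrow> 'a \<Rightarrow> real" where
  "test t Z j \<omega> = of_bool (\<bar>Z \<omega> $ j\<bar> > \<bar>quantile_half t\<bar>)"

definition \<xi> :: "real \<Rightarrow> real ^ 'n \<Rightarrow> 'n \<Rightarrow> real" where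
  "\<xi> t \<mu> j = \<Phi> (quantile_half t + \<mu> $ j) + \<Phi> (quantile_half t - \<mu> $ j)"

definition \<xi>_bar :: "real \<Rightarrow> real ^ 'n \<Rightarrow> real" where
  "\<xi>_bar t \<mu> = 1 / real (card (false_nulls \<mu>)) * (\<Sum>j\<in>false_nulls \<mu>. \<xi> t \<mu> j)"

definition V2 ::
    "'a measure \<Rightarrow> ('a \<Rightarrow> real ^ 'n::{finite,linorder}) \<Rightarrow> real ^ 'n::{finite,linorder} \<Rightarrow> real \<Rightarrow> real" where
  "V2 M Z \<mu> t =
    (let p0 = real (card (true_nulls \<mu>));
         p1 = real (card (false_nulls \<mu>));
         x = \<xi>_bar t \<mu>;
         C = (\<lambda>i j. covariance M (test t Z i) (test t Z j))
     in 2 * p1\<^sup>2 * x\<^sup>2 / (p0 * t + p1 * x) ^ 4 *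
          (\<Sum>(i, j)\<in>{(i, j). i < j \<and> i \<in> true_nulls \<mu> \<and> j \<in> true_nulls \<mu>}. C i j)
      - 2 * p0 * p1 * t * x / (p0 * t + p1 * x) ^ 4 *
          (\<Sum>(i, j)\<in>true_nulls \<mu> \<times> false_nulls \<mu>. C i j)
      + 2 * p0\<^sup>2 * t\<^sup>2 / (p0 * t + p1 * x) ^ 4 *
          (\<Sum>(i, j)\<in>{(i, j). i < j \<and> i \<in> false_nulls \<mu> \<and> j \<in> false_nulls \<mu>}. C i j))"

end

theory Submission
  imports Defs
begin

text \<open>
  Passing to the complementary events, each covariance is that of two Gaussian bands
  \<open>\<bar>m + u \<bullet> W\<bar> \<le> c\<close> and \<open>\<bar>n + v \<bullet> W\<bar> \<le> c\<close>, with \<open>u\<close>, \<open>v\<close> unit rows of \<open>A\<close>, \<open>c = \<bar>z\<bar>\<close> and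
  correlation \<open>r = u \<bullet> v\<close>, which may be made nonnegative by flipping signs. By Plackett's identity the
  probability of the rectangle has as \<open>r\<close>-derivative the alternating sum of the bivariate normal density over
  its four corners, and at \<open>r = 0\<close> it is the product of the marginals. The corner sum is
  nonnegative for two true nulls, nonpositive for a true and a false null (this needs \<open>ln 3 \<le> 2 c\<^sup>2\<close>),
  and positive for two false nulls, so each of the three terms of \<open>V2\<close> is nonnegative and the last
  one is positive. Correlation \<open>1\<close>, where the density degenerates, is treated directly.
\<close>

section \<open>Rotation invariance and the bivariate law\<close>

lemma borel_measurable_vec_nth [measurable]: "(\<lambda>w :: real ^ 'n::finite. w $ i) \<in> borel_measurable borel"
  by (intro borel_measurable_continuous_onI continuous_intros)

lemma borel_measurable_orthogonal_transformation:
  fixes T :: "'a::euclidean_space \<Rightarrow> 'a"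
  shows "orthogonal_transformation T \<Longrightarrow> T \<in> borel_measurable borel"
  by (intro borel_measurable_continuous_onI linear_continuous_on)
    (simp add: linear_conv_bounded_linear[symmetric] orthogonal_transformation_linear)

section \<open>Lebesgue measure under translations, reflections and linear isometries\<close>

lemma nn_integral_lborel_translate:
  fixes a :: "'a::euclidean_space"
  assumes [measurable]: "f \<in> borel_measurable borel"
  shows "(\<integral>\<^sup>+x. f (x + a) \<partial>lborel) = (\<integral>\<^sup>+x. f x \<partial>lborel)"
proof -
  have "(\<integral>\<^sup>+x. f x \<partial>lborel) = (\<integral>\<^sup>+x. f x \<partial>distr lborel borel ((+) a))"
    by (simp add: lborel_distr_plus)
  also have "\<dots> = (\<integral>\<^sup>+x. f (x + a) \<partial>lborel)"
    by (subst nn_integral_distr) (auto simp: add.commute)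
  finally show ?thesis by simp
qed

lemma nn_integral_lborel_reflect:
  fixes a :: "'a::euclidean_space"
  assumes [measurable]: "f \<in> borel_measurable borel"
  shows "(\<integral>\<^sup>+x. f (a - x) \<partial>lborel) = (\<integral>\<^sup>+x. f x \<partial>lborel)"
proof -
  have "lborel = distr lborel borel (\<lambda>x. a - x)"
    using lborel_affine[of "-1" a] by (simp add: density_1)
  then have "(\<integral>\<^sup>+x. f x \<partial>lborel) = (\<integral>\<^sup>+x. f x \<partial>distr lborel borel (\<lambda>x. a - x))"
    by simp
  also have "\<dots> = (\<integral>\<^sup>+x. f (a - x) \<partial>lborel)"
    by (subst nn_integral_distr) auto
  finally show ?thesis by simp
qed

text \<open>
  The uniqueness argument for Haar measure: Fubini and translation invariance give
  \<open>\<mu> A * \<lambda> B = \<mu> B * \<lambda> (- A)\<close>, and the unit ball \<open>B\<close> satisfies \<open>\<mu> B = \<lambda> B\<close>.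
  The library version \<open>measure_orthogonal_image\<close> requires a well-ordered index type.
\<close>
lemma distr_lborel_orthogonal_transformation:
  fixes T :: "'a::euclidean_space \<Rightarrow> 'a"
  assumes T: "orthogonal_transformation T"
  shows "distr lborel borel T = lborel"
proof (rule measure_eqI)
  have lin: "linear T"
    using T by (rule orthogonal_transformation_linear)
  note [measurable] = borel_measurable_orthogonal_transformation[OF T]
  have surj: "\<exists>x. T x = y" for y
    using orthogonal_transformation_surj[OF T] by (metis surjD)
  show "sets (distr lborel borel T) = sets lborel"
    by simp
  fix A assume "A \<in> sets (distr lborel borel T)"
  then have A[measurable]: "A \<in> sets borel"
    by simp
  define B where "B = ball (0::'a) 1"
  have [measurable]: "B \<in> sets borel"
    unfolding B_def by simp
  have TB: "indicator B (T x) = (indicator B x :: ennreal)" for x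
    using orthogonal_transformation_norm[OF T] by (simp add: B_def indicator_def)
  let ?a = "\<lambda>x. indicator A x :: ennreal" and ?b = "\<lambda>x. indicator B x :: ennreal"
  have "emeasure (distr lborel borel T) A * emeasure lborel B
      = (\<integral>\<^sup>+x. ?a (T x) \<partial>lborel) * (\<integral>\<^sup>+y. ?b y \<partial>lborel)"
    by (simp add: nn_integral_distr flip: nn_integral_indicator)
  also have "\<dots> = (\<integral>\<^sup>+x. (\<integral>\<^sup>+y. ?a (T x) * ?b (y + T x) \<partial>lborel) \<partial>lborel)"
    by (simp add: nn_integral_cmult nn_integral_multc nn_integral_lborel_translate[where f="?b"]
        del: nn_integral_indicator)
  also have "\<dots> = (\<integral>\<^sup>+y. (\<integral>\<^sup>+x. ?a (T x) * ?b (y + T x) \<partial>lborel) \<partial>lborel)"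
    by (rule lborel_pair.Fubini') measurable
  also have "\<dots> = (\<integral>\<^sup>+y. (\<integral>\<^sup>+x. ?a (T x - y) * ?b (T x) \<partial>lborel) \<partial>lborel)"
  proof (rule nn_integral_cong)
    fix y
    \<comment> \<open>Shifting \<open>x\<close> by a preimage of \<open>- y\<close> moves the
      translation from the ball over to \<open>A\<close>.\<close>
    obtain s where s: "T s = - y"
      using surj by blast
    have "(\<integral>\<^sup>+x. ?a (T x) * ?b (y + T x) \<partial>lborel)
        = (\<integral>\<^sup>+x. ?a (T (x + s)) * ?b (y + T (x + s)) \<partial>lborel)"
      by (rule nn_integral_lborel_translate[symmetric]) measurable
    then show "(\<integral>\<^sup>+x. ?a (T x) * ?b (y + T x) \<partial>lborel) = (\<integral>\<^sup>+x. ?a (T x - y) * ?b (T x) \<partial>lborel)"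
      by (simp add: linear_add[OF lin] s)
  qed
  also have "\<dots> = (\<integral>\<^sup>+x. (\<integral>\<^sup>+y. ?a (T x - y) * ?b (T x) \<partial>lborel) \<partial>lborel)"
    by (rule lborel_pair.Fubini') measurable
  also have "\<dots> = emeasure lborel A * emeasure lborel B"
    by (simp add: nn_integral_cmult nn_integral_multc nn_integral_lborel_reflect[where f="?a"] TB)
  finally have "emeasure (distr lborel borel T) A * emeasure lborel B = emeasure lborel A * emeasure lborel B" .
  moreover have "emeasure lborel B \<noteq> 0"
  proof -
    have "0 < measure lebesgue B"
      unfolding B_def using content_ball_pos[of 1 "0::'a"] by simp
    then show ?thesis
      by (metis \<open>B \<in> sets borel\<close> enn2real_0 less_irrefl measure_completion measure_def sets_lborel)
  qed
  moreover have "emeasure lborel B \<noteq> \<infinity>"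
    unfolding B_def using emeasure_bounded_finite[of "ball (0::'a) 1"] by auto
  ultimately show "emeasure (distr lborel borel T) A = emeasure lborel A"
    by (metis ennreal_mult_divide_eq infinity_ennreal_def)
qed

section \<open>Reflections in hyperplanes and the isometries built from them\<close>

definition householder :: "'a::real_inner \<Rightarrow> 'a \<Rightarrow> 'a" where
  "householder a x = x - (2 * (x \<bullet> a) / (a \<bullet> a)) *\<^sub>R a"

lemma orthogonal_transformation_householder: "orthogonal_transformation (householder (a::'a::euclidean_space))"
proof (cases "a = 0")
  case True
  \<comment> \<open>For \<open>a = 0\<close> the quotient is a division by zero, hence 0, and the
    map is the identity.\<close>
  then have "householder a = (\<lambda>x. x)" by (simp add: householder_def fun_eq_iff)
  then show ?thesis by simp
next
  case False
  have "linear (householder a)"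
    by (rule linearI) (simp_all add: householder_def inner_add_left algebra_simps add_divide_distrib)
  moreover have "householder a v \<bullet> householder a w = v \<bullet> w" for v w
    using False by (simp add: householder_def inner_diff_left inner_diff_right inner_commute field_simps)
  ultimately show ?thesis
    by (simp add: orthogonal_transformation_def)
qed

text \<open>Vectors of equal norm lie symmetrically about the hyperplane orthogonal to
  \<open>p - q\<close>. In formulas, |p - q|^2 is twice the inner product of \<open>p\<close> with
  \<open>p - q\<close>, so the reflection subtracts exactly \<open>p - q\<close>.\<close>

lemma householder_swap:
  fixes p q :: "'a::euclidean_space"
  assumes "norm p = norm q"
  shows "householder (p - q) p = q"
proof (cases "p = q")
  case False
  have "(p - q) \<bullet> (p - q) = 2 * (p \<bullet> (p - q))"
    using assms by (simp add: inner_diff_left inner_diff_right inner_commute norm_eq)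
  moreover have "(p - q) \<bullet> (p - q) \<noteq> 0"
    using False by simp
  ultimately have "2 * (p \<bullet> (p - q)) / ((p - q) \<bullet> (p - q)) = 1"
    by (metis divide_self)
  then show ?thesis
    unfolding householder_def by (simp only: scaleR_one) simp
qed (simp add: householder_def)

lemma householder_orthogonal: "x \<bullet> a = 0 \<Longrightarrow> householder a x = x"
  by (simp add: householder_def)

text \<open>Two reflections suffice. The first takes \<open>u\<close> to \<open>p\<close>; the
  second takes the image of \<open>w\<close> to \<open>q\<close> and fixes \<open>p\<close>, because
  \<open>p\<close> is orthogonal to both of these vectors.\<close>

lemma exists_orthogonal_transformation_pair:
  fixes u w p q :: "'a::euclidean_space"
  assumes "norm u = norm p" "norm w = norm q" "u \<bullet> w = 0" "p \<bullet> q = 0"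
  obtains T where "orthogonal_transformation T" "T u = p" "T w = q"
proof
  let ?R = "householder (u - p)"
  let ?S = "householder (?R w - q)"
  have R: "orthogonal_transformation ?R" and S: "orthogonal_transformation ?S"
    by (rule orthogonal_transformation_householder)+
  show "orthogonal_transformation (?S \<circ> ?R)"
    using S R by (rule orthogonal_transformation_compose)
  have Ru: "?R u = p"
    by (rule householder_swap) fact
  have "p \<bullet> ?R w = 0"
    using R assms(3) Ru unfolding orthogonal_transformation_def by metis
  then show "(?S \<circ> ?R) u = p"
    using assms(4) by (simp add: Ru householder_orthogonal inner_diff_right)
  have "norm (?R w) = norm q"
    using R assms(2) by (simp add: orthogonal_transformation)
  then show "(?S \<circ> ?R) w = q"
    by (simp add: householder_swap)
qed

section \<open>Isotropy and product structure of the standard Gaussian vector\<close>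

lemma prod_std_normal_density:
  "(\<Prod>i\<in>UNIV. std_normal_density (w $ i)) = (1 / sqrt (2 * pi)) ^ CARD('n) * exp (- (norm w)\<^sup>2 / 2)"
  for w :: "real ^ 'n"
proof -
  have "(norm w)\<^sup>2 = (\<Sum>i\<in>UNIV. (w $ i)\<^sup>2)"
    by (simp add: norm_vec_def L2_set_def sum_nonneg)
  then show ?thesis
    unfolding std_normal_density_def prod.distrib
    by (simp add: sum_negf sum_divide_distrib flip: exp_sum)
qed

text \<open>The density depends on the norm alone and Lebesgue measure is invariant, so an isometry
  preserves both factors of the Gaussian law.\<close>

lemma distr_std_gaussian_orthogonal_transformation:
  fixes T :: "real ^ 'n \<Rightarrow> real ^ 'n"
  assumes T: "orthogonal_transformation T"
  shows "distr std_gaussian borel T = std_gaussian"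
proof -
  note [measurable] = borel_measurable_orthogonal_transformation[OF T]
  let ?g = "\<lambda>w::real^'n. ennreal ((1 / sqrt (2 * pi)) ^ CARD('n) * exp (- (norm w)\<^sup>2 / 2))"
  have sg: "(std_gaussian :: (real^'n) measure) = density lborel ?g"
    by (simp add: std_gaussian_def prod_std_normal_density)
  have "std_gaussian = density (distr lborel borel T) ?g"
    by (simp add: sg distr_lborel_orthogonal_transformation[OF T])
  also have "\<dots> = distr (density lborel (\<lambda>w. ?g (T w))) borel T"
    by (subst density_distr) auto
  also have "\<dots> = distr std_gaussian borel T"
    by (simp add: sg orthogonal_transformation_norm[OF T])
  finally show ?thesis by simp
qed

lemma sets_std_gaussian [simp, measurable_cong]: "sets std_gaussian = sets borel"
  by (simp add: std_gaussian_def)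

lemma space_std_gaussian [simp]: "space std_gaussian = UNIV"
  by (simp add: std_gaussian_def)

lemma nn_integral_std_gaussian_prod:
  fixes f :: "'n::finite \<Rightarrow> real \<Rightarrow> ennreal"
  assumes [measurable]: "\<And>i. f i \<in> borel_measurable borel"
  shows "(\<integral>\<^sup>+w. (\<Prod>i\<in>UNIV. f i (w $ i)) \<partial>(std_gaussian :: (real^'n) measure))
       = (\<Prod>i\<in>UNIV. \<integral>\<^sup>+x. f i x \<partial>std_normal_distribution)"
proof -
  let ?h = "\<lambda>i x. ennreal (std_normal_density x) * f i x"
  \<comment> \<open>The product formula for \<open>lborel\<close> runs over basis vectors.
    \<open>THE\<close> reads the coordinate index back from the vector, unambiguously since distinct
    indices give distinct axes.\<close>
  define g where "g b = ?h (THE i. b = axis i (1::real))" for b :: "real^'n"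
  have g: "g (axis i 1) = ?h i" for i
    unfolding g_def by (simp add: axis_eq_axis)
  have B: "(Basis :: (real^'n) set) = range (\<lambda>i. axis i 1)"
    by (auto simp: Basis_vec_def)
  have inj: "inj (\<lambda>i::'n. axis i (1::real))"
    by (auto simp: inj_on_def axis_eq_axis)
  have "(\<integral>\<^sup>+w. (\<Prod>i\<in>UNIV. f i (w $ i)) \<partial>(std_gaussian :: (real^'n) measure))
      = (\<integral>\<^sup>+w. (\<Prod>i\<in>UNIV. ?h i (w $ i)) \<partial>lborel)"
    unfolding std_gaussian_def
    by (subst nn_integral_density) (auto simp: prod.distrib prod_ennreal)
  also have "\<dots> = (\<integral>\<^sup>+w. (\<Prod>b\<in>Basis. g b (w \<bullet> b)) \<partial>lborel)"
    unfolding B by (subst prod.reindex[OF inj]) (simp add: g inner_axis)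
  also have "\<dots> = (\<Prod>b\<in>Basis. \<integral>\<^sup>+x. g b x \<partial>lborel)"
    by (rule nn_integral_lborel_prod) (auto simp: g_def)
  also have "\<dots> = (\<Prod>i\<in>UNIV. \<integral>\<^sup>+x. ?h i x \<partial>lborel)"
    unfolding B by (subst prod.reindex[OF inj]) (simp add: g)
  also have "\<dots> = (\<Prod>i\<in>UNIV. \<integral>\<^sup>+x. f i x \<partial>std_normal_distribution)"
    by (simp add: nn_integral_density)
  finally show ?thesis .
qed

interpretation std_normal: real_distribution std_normal_distribution
  by (rule real_dist_normal_dist)

lemma emeasure_std_gaussian_coordinates:
  fixes i j :: "'n::finite"
  assumes "i \<noteq> j" and [measurable]: "A \<in> sets borel" "B \<in> sets borel"
  shows "emeasure std_gaussian {w :: real^'n. w $ i \<in> A \<and> w $ j \<in> B}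
       = emeasure std_normal_distribution A * emeasure std_normal_distribution B"
proof -
  \<comment> \<open>All coordinates other than \<open>i\<close> and \<open>j\<close> receive the
    constant factor 1, which integrates to 1.\<close>
  let ?f = "\<lambda>k x. if k = i then indicator A x else if k = j then indicator B x else 1 :: ennreal"
  have split: "(\<Prod>k\<in>UNIV. g k) = g i * g j" if "\<And>k. k \<noteq> i \<Longrightarrow> k \<noteq> j \<Longrightarrow> g k = 1" for g :: "'n \<Rightarrow> ennreal"
  proof -
    have "(\<Prod>k\<in>UNIV. g k) = (\<Prod>k\<in>{i, j}. g k)"
      using that by (intro prod.mono_neutral_right) auto
    then show ?thesis using \<open>i \<noteq> j\<close> by simp
  qed
  have "emeasure std_gaussian {w :: real^'n. w $ i \<in> A \<and> w $ j \<in> B}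
      = (\<integral>\<^sup>+w. indicator {w. w $ i \<in> A \<and> w $ j \<in> B} w \<partial>std_gaussian)"
    by (subst nn_integral_indicator) auto
  also have "\<dots> = (\<integral>\<^sup>+w. (\<Prod>k\<in>UNIV. ?f k (w $ k)) \<partial>std_gaussian)"
    using \<open>i \<noteq> j\<close> by (intro nn_integral_cong) (subst split, auto simp: indicator_def)
  also have "\<dots> = (\<Prod>k\<in>UNIV. \<integral>\<^sup>+x. ?f k x \<partial>std_normal_distribution)"
    by (rule nn_integral_std_gaussian_prod) measurable
  also have "\<dots> = emeasure std_normal_distribution A * emeasure std_normal_distribution B"
    using \<open>i \<noteq> j\<close> std_normal.emeasure_space_1 by (subst split) auto
  finally show ?thesis .
qed

lemma distr_std_gaussian_coordinates:
  fixes i j :: "'n::finite"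
  assumes "i \<noteq> j"
  shows "distr std_gaussian (borel \<Otimes>\<^sub>M borel) (\<lambda>w :: real^'n. (w $ i, w $ j))
       = std_normal_distribution \<Otimes>\<^sub>M std_normal_distribution"
proof (rule pair_measure_eqI[symmetric])
  show "sigma_finite_measure std_normal_distribution" "sigma_finite_measure std_normal_distribution"
    by (rule std_normal.sigma_finite_measure_axioms)+
  show "sets (std_normal_distribution \<Otimes>\<^sub>M std_normal_distribution)
      = sets (distr std_gaussian (borel \<Otimes>\<^sub>M borel) (\<lambda>w :: real^'n. (w $ i, w $ j)))"
    by simp
  fix A B assume "A \<in> sets std_normal_distribution" "B \<in> sets std_normal_distribution"
  then have [measurable]: "A \<in> sets borel" "B \<in> sets borel" by auto
  have "emeasure (distr std_gaussian (borel \<Otimes>\<^sub>M borel) (\<lambda>w :: real^'n. (w $ i, w $ j))) (A \<times> B)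
     = emeasure std_gaussian {w :: real^'n. w $ i \<in> A \<and> w $ j \<in> B}"
    by (subst emeasure_distr) (auto intro!: arg_cong[where f="emeasure std_gaussian"])
  then show "emeasure std_normal_distribution A * emeasure std_normal_distribution B
    = emeasure (distr std_gaussian (borel \<Otimes>\<^sub>M borel) (\<lambda>w :: real^'n. (w $ i, w $ j))) (A \<times> B)"
    using emeasure_std_gaussian_coordinates[OF assms] by simp
qed

text \<open>An isometry carrying \<open>u\<close> and \<open>w\<close> to the axes \<open>i\<close>
  and \<open>j\<close> preserves the Gaussian law, so the pair is distributed like two
  coordinates.\<close>

lemma distr_std_gaussian_orthonormal:
  fixes u w :: "real ^ 'n::finite" and i j :: "'n::finite"
  assumes "i \<noteq> j" "norm u = 1" "norm w = 1" "u \<bullet> w = 0"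
  shows "distr std_gaussian (borel \<Otimes>\<^sub>M borel) (\<lambda>x. (u \<bullet> x, w \<bullet> x))
       = std_normal_distribution \<Otimes>\<^sub>M std_normal_distribution"
proof -
  obtain T :: "real^'n \<Rightarrow> real^'n"
    where T: "orthogonal_transformation T" "T u = axis i 1" "T w = axis j 1"
  proof (rule exists_orthogonal_transformation_pair)
    show "norm u = norm (axis i 1 :: real^'n)" "norm w = norm (axis j 1 :: real^'n)"
      using assms by simp_all
    show "u \<bullet> w = 0" "axis i 1 \<bullet> (axis j 1 :: real^'n) = 0"
      using assms by (simp_all add: inner_axis_axis)
  qed blast
  note [measurable] = borel_measurable_orthogonal_transformation[OF T(1)]
  have uT: "u \<bullet> x = T x $ i" and wT: "w \<bullet> x = T x $ j" for x
  proof -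
    have "u \<bullet> x = T u \<bullet> T x" "w \<bullet> x = T w \<bullet> T x"
      using T(1) by (simp_all add: orthogonal_transformation_def)
    then show "u \<bullet> x = T x $ i" "w \<bullet> x = T x $ j"
      by (simp_all add: T inner_axis')
  qed
  have "distr std_gaussian (borel \<Otimes>\<^sub>M borel) (\<lambda>x. (u \<bullet> x, w \<bullet> x))
      = distr (distr std_gaussian borel T) (borel \<Otimes>\<^sub>M borel) (\<lambda>x. (x $ i, x $ j))"
    by (subst distr_distr) (auto simp: uT wT comp_def)
  then show ?thesis
    by (simp add: distr_std_gaussian_orthogonal_transformation[OF T(1)] distr_std_gaussian_coordinates[OF assms(1)])
qed

section \<open>The rectangle probability as a function of the correlation\<close>

lemma continuous_on_std_normal_density [continuous_intros]:
  "continuous_on S f \<Longrightarrow> continuous_on S (\<lambda>x. std_normal_density (f x))"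
  unfolding std_normal_density_def by (intro continuous_intros) auto

lemma DERIV_std_normal_density [derivative_intros]:
  assumes "(f has_real_derivative D) (at x within S)"
  shows "((\<lambda>x. std_normal_density (f x)) has_real_derivative - f x * std_normal_density (f x) * D) (at x within S)"
  unfolding std_normal_density_def by (rule derivative_eq_intros assms refl | simp)+

text \<open>Passage from the Lebesgue integral to the gauge integral \<open>integral\<close>, for
  which the Leibniz rule and the fundamental theorem of calculus are used below.\<close>

lemma nn_integral_std_normal_Icc:
  fixes f :: "real \<Rightarrow> real"
  assumes [measurable]: "f \<in> borel_measurable borel" and f: "\<And>x. f x \<ge> 0" "continuous_on {a..b} f"
  shows "(\<integral>\<^sup>+x. indicator {a..b} x * ennreal (f x) \<partial>std_normal_distribution)
       = ennreal (integral {a..b} (\<lambda>x. std_normal_density x * f x))"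
proof -
  have "(\<lambda>x. std_normal_density x * f x) integrable_on {a..b}"
    by (intro integrable_continuous_interval continuous_intros f)
  then have "((\<lambda>x. std_normal_density x * f x) has_integral integral {a..b} (\<lambda>x. std_normal_density x * f x)) {a..b}"
    by (rule integrable_integral)
  then have "(\<integral>\<^sup>+x. indicator {a..b} x * (std_normal_density x * f x) \<partial>lborel)
      = ennreal (integral {a..b} (\<lambda>x. std_normal_density x * f x))"
    using f by (intro nn_integral_has_integral_lebesgue) auto
  moreover have "(\<integral>\<^sup>+x. indicator {a..b} x * (std_normal_density x * f x) \<partial>lborel) = (\<integral>\<^sup>+x. indicator {a..b} x * ennreal (f x) \<partial>std_normal_distribution)"
    by (subst nn_integral_density)
       (auto intro!: nn_integral_cong simp: f indicator_def ennreal_mult)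
  ultimately show ?thesis by simp
qed

lemma measure_std_normal_Icc: "measure std_normal_distribution {a..b} = integral {a..b} std_normal_density"
proof -
  have "emeasure std_normal_distribution {a..b} = ennreal (integral {a..b} std_normal_density)"
    using nn_integral_std_normal_Icc[of "\<lambda>_. 1" a b] by simp
  moreover have "integral {a..b} std_normal_density \<ge> 0"
    by (simp add: integral_nonneg integrable_continuous_interval continuous_intros)
  ultimately show ?thesis
    by (simp add: measure_def)
qed

lemma measure_std_normal_singleton: "measure std_normal_distribution {a} = 0"
  using measure_std_normal_Icc[of a a] by simp

lemma \<Phi>_diff:
  assumes "a \<le> b"
  shows "\<Phi> b - \<Phi> a = measure std_normal_distribution {a..b}"
proof (cases "a = b")
  case False
  then have "\<Phi> b - \<Phi> a = measure std_normal_distribution {a<..b}"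
    using assms by (simp add: \<Phi>_def std_normal.cdf_diff_eq)
  moreover have "measure std_normal_distribution {a..b} = measure std_normal_distribution {a<..b} + measure std_normal_distribution {a}"
    using assms by (subst std_normal.finite_measure_Union[symmetric]) (auto intro!: arg_cong2[where f=measure])
  ultimately show ?thesis
    by (simp add: measure_std_normal_singleton)
qed (simp add: measure_std_normal_singleton)

text \<open>Near \<open>x\<close> the function \<Phi> is a constant plus an integral with moving
  upper end. Starting the integral at \<open>x - 1\<close> makes \<open>x\<close> an interior point,
  so that the derivative is two-sided.\<close>

lemma DERIV_\<Phi>: "(\<Phi> has_real_derivative std_normal_density x) (at x)"
proof -
  have "((\<lambda>u. integral {x - 1..u} std_normal_density) has_real_derivative std_normal_density x) (at x within {x - 1..x + 1})"
    by (rule integral_has_real_derivative) (auto intro!: continuous_intros)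
  then have "((\<lambda>u. integral {x - 1..u} std_normal_density) has_real_derivative std_normal_density x) (at x)"
    by (simp add: at_within_Icc_at)
  then have "((\<lambda>u. \<Phi> (x - 1) + integral {x - 1..u} std_normal_density) has_real_derivative std_normal_density x) (at x)"
    by (auto intro!: derivative_eq_intros)
  moreover have "\<forall>\<^sub>F u in nhds x. \<Phi> (x - 1) + integral {x - 1..u} std_normal_density = \<Phi> u"
    using eventually_nhds_in_open[of "{x - 1<..}" x]
  proof (rule eventually_mono)
    show "\<Phi> (x - 1) + integral {x - 1..u} std_normal_density = \<Phi> u" if "u \<in> {x - 1<..}" for u
      using \<Phi>_diff[of "x - 1" u] that by (simp add: measure_std_normal_Icc)
  qed auto
  then have "((\<lambda>u. \<Phi> (x - 1) + integral {x - 1..u} std_normal_density) has_real_derivative std_normal_density x) (at x)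
      \<longleftrightarrow> (\<Phi> has_real_derivative std_normal_density x) (at x)"
    by (intro DERIV_cong_ev refl)
  ultimately show ?thesis
    by (rule iffD1[rotated])
qed

lemma DERIV_\<Phi>_compose [derivative_intros]:
  "(f has_real_derivative D) (at x within S) \<Longrightarrow>
   ((\<lambda>x. \<Phi> (f x)) has_real_derivative std_normal_density (f x) * D) (at x within S)"
  by (rule DERIV_chain2[OF DERIV_\<Phi>])

lemma continuous_on_\<Phi> [continuous_intros]: "continuous_on S f \<Longrightarrow> continuous_on S (\<lambda>x. \<Phi> (f x))"
  using continuous_on_compose2[of UNIV \<Phi> S f] DERIV_\<Phi>
  by (meson DERIV_isCont continuous_at_imp_continuous_on subset_UNIV)

lemma \<Phi>_strict_mono: "a < b \<Longrightarrow> \<Phi> a < \<Phi> b"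
  by (rule DERIV_pos_imp_increasing[of a b \<Phi>]) (use DERIV_\<Phi> normal_density_pos in \<open>auto intro!: exI\<close>)

lemma \<Phi>_mono: "a \<le> b \<Longrightarrow> \<Phi> a \<le> \<Phi> b"
  using \<Phi>_strict_mono[of a b] by fastforce

lemma \<Phi>_measurable [measurable]: "\<Phi> \<in> borel_measurable borel"
  by (intro borel_measurable_continuous_onI continuous_on_\<Phi> continuous_on_id)

text \<open>\<open>P (X \<le> y, a \<le> W \<le> b)\<close> for standard normal \<open>W\<close>, \<open>X\<close> with correlation \<open>r\<close>, \<open>\<bar>r\<bar> < 1\<close>.\<close>
definition strip_prob :: "real \<Rightarrow> real \<Rightarrow> real \<Rightarrow> real \<Rightarrow> real" where
  "strip_prob a b y r = integral {a..b} (\<lambda>x. std_normal_density x * \<Phi> ((y - r * x) / sqrt (1 - r\<^sup>2)))"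

text \<open>Joint density of two standard normals with correlation \<open>r\<close>, factored into
  the marginal at \<open>x\<close> and the conditional density at \<open>y\<close>, which is normal
  with mean \<open>r * x\<close> and variance 1 - r^2. This is the shape in which differentiating
  \<open>strip_prob\<close> produces it.\<close>

definition binormal_density :: "real \<Rightarrow> real \<Rightarrow> real \<Rightarrow> real" where
  "binormal_density r x y = std_normal_density x * std_normal_density ((y - r * x) / sqrt (1 - r\<^sup>2)) / sqrt (1 - r\<^sup>2)"

text \<open>
  Plackett's identity: the \<open>r\<close>-derivative of the integrand is the \<open>x\<close>-derivative of
  \<open>binormal_density r x y\<close>.
\<close>
lemma DERIV_strip_prob:
  assumes "a \<le> b" "\<bar>r\<bar> < 1"
  shows "(strip_prob a b y has_real_derivative binormal_density r b y - binormal_density r a y) (at r)"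
proof -
  let ?s = "\<lambda>r. sqrt (1 - r\<^sup>2)"
  let ?d = "\<lambda>r x. std_normal_density x * (std_normal_density ((y - r * x) / ?s r) * ((r * y - x) / ?s r ^ 3))"
  have pos: "0 < 1 - r\<^sup>2" if "r \<in> {-1<..<1}" for r :: real
    using that abs_square_less_1[of r] by auto
  have "((\<lambda>r. integral (cbox a b) (\<lambda>x. std_normal_density x * \<Phi> ((y - r * x) / ?s r))) has_real_derivative
      integral (cbox a b) (?d r)) (at r within {-1<..<1})"
  proof (rule leibniz_rule_field_derivative)
    fix r x :: real assume r: "r \<in> {-1<..<1}"
    have "((\<lambda>r. (y - r * x) / ?s r) has_real_derivative (r * y - x) / ?s r ^ 3) (at r within {-1<..<1})"
    proof (rule DERIV_cong)
      have s: "?s r > 0" "(?s r)\<^sup>2 = 1 - r\<^sup>2"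
        using pos[OF r] by simp_all
      have "(?s has_real_derivative - r / ?s r) (at r within {-1<..<1})"
        using pos[OF r] by (auto intro!: derivative_eq_intros simp: field_simps)
      moreover have "((\<lambda>r. y - r * x) has_real_derivative - x) (at r within {-1<..<1})"
        by (auto intro!: derivative_eq_intros)
      ultimately show "((\<lambda>r. (y - r * x) / ?s r) has_real_derivative
          (- x * ?s r - (y - r * x) * (- r / ?s r)) / (?s r * ?s r)) (at r within {-1<..<1})"
        using s(1) by (intro DERIV_divide) simp_all
      have "(- x * ?s r - (y - r * x) * (- r / ?s r)) * ?s r = - x * (?s r)\<^sup>2 + (y - r * x) * r"
        using s(1) by (simp add: field_simps power2_eq_square)
      also have "\<dots> = r * y - x"
        unfolding s(2) by (simp add: algebra_simps power2_eq_square)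
      finally show "(- x * ?s r - (y - r * x) * (- r / ?s r)) / (?s r * ?s r) = (r * y - x) / ?s r ^ 3"
        using s(1) by (simp add: field_simps power3_eq_cube)
    qed
    then show "((\<lambda>r. std_normal_density x * \<Phi> ((y - r * x) / ?s r)) has_real_derivative ?d r x) (at r within {-1<..<1})"
      by (intro DERIV_cmult DERIV_\<Phi>_compose)
  next
    fix r :: real assume r: "r \<in> {-1<..<1}"
    show "(\<lambda>x. std_normal_density x * \<Phi> ((y - r * x) / ?s r)) integrable_on cbox a b"
      using pos[OF r] by (intro integrable_continuous continuous_intros) auto
  next
    show "continuous_on ({-1<..<1} \<times> cbox a b) (\<lambda>(r, x). ?d r x)"
      unfolding case_prod_unfold using pos by (intro continuous_intros) (auto simp: less_le)
  next
    show "r \<in> {-1<..<1}" "convex {-1<..<1::real}"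
      using assms by auto
  qed
  moreover have "integral (cbox a b) (?d r) = binormal_density r b y - binormal_density r a y"
    unfolding cbox_interval
  proof (intro integral_unique fundamental_theorem_of_calculus)
    have r: "0 < 1 - r\<^sup>2"
      using assms by (intro pos) auto
    fix x
    have "((\<lambda>x. binormal_density r x y) has_real_derivative ?d r x) (at x within {a..b})"
      unfolding binormal_density_def
    proof (rule DERIV_cong)
      have s: "?s r > 0" "(?s r)\<^sup>2 = 1 - r\<^sup>2"
        using r by simp_all
      let ?q = "(y - r * x) / ?s r"
      have "((\<lambda>x. (y - r * x) / ?s r) has_real_derivative - r / ?s r) (at x within {a..b})"
        by (rule DERIV_cdivide) (auto intro!: derivative_eq_intros)
      from DERIV_cdivide[OF DERIV_mult'[OF DERIV_std_normal_density[OF DERIV_ident] DERIV_std_normal_density[OF this]]]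
      show "((\<lambda>x. std_normal_density x * std_normal_density ((y - r * x) / ?s r) / ?s r) has_real_derivative
          (std_normal_density x * (- ?q * std_normal_density ?q * (- r / ?s r)) +
            - x * std_normal_density x * std_normal_density ?q) / ?s r) (at x within {a..b})"
        by (simp only: mult_1_right)
      have "?q * (r / ?s r) - x = (r * y - x) / (?s r)\<^sup>2"
      proof -
        have "(?q * (r / ?s r) - x) * (?s r)\<^sup>2 = (y - r * x) * r - x * (?s r)\<^sup>2"
          using s(1) by (simp add: field_simps power2_eq_square)
        also have "\<dots> = r * y - x"
          unfolding s(2) by (simp add: algebra_simps power2_eq_square)
        finally show ?thesis
          using s(1) by (simp add: eq_divide_eq)
      qed
      moreover have "(std_normal_density x * (- ?q * std_normal_density ?q * (- r / ?s r)) +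
            - x * std_normal_density x * std_normal_density ?q) / ?s r
          = std_normal_density x * (std_normal_density ?q * ((?q * (r / ?s r) - x) / ?s r))"
        by (simp add: algebra_simps add_divide_distrib diff_divide_distrib)
      ultimately show "(std_normal_density x * (- ?q * std_normal_density ?q * (- r / ?s r)) +
            - x * std_normal_density x * std_normal_density ?q) / ?s r = ?d r x"
        by (simp add: power3_eq_cube power2_eq_square)
    qed
    then show "((\<lambda>x. binormal_density r x y) has_vector_derivative ?d r x) (at x within {a..b})"
      by (rule has_real_derivative_iff_has_vector_derivative[THEN iffD1])
  qed fact
  moreover have "at r within {-1<..<1} = at r"
    using assms by (intro at_within_open) auto
  ultimately show ?thesis
    unfolding strip_prob_def[abs_def] cbox_interval by (simp only:)
qed

text \<open>Gram-Schmidt writes \<open>v\<close> as \<open>r *\<^sub>R u + s *\<^sub>R w\<close>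
  with \<open>w\<close> a unit vector orthogonal to \<open>u\<close>. The two projections are then X
  and r X + s Y for independent standard normals X and Y, and Fubini conditions on X.\<close>

lemma measure_std_gaussian_box:
  fixes u v :: "real ^ 'n::finite" and i j :: "'n::finite"
  assumes "i \<noteq> j" "norm u = 1" "norm v = 1" "\<bar>u \<bullet> v\<bar> < 1" "a2 \<le> b2"
  shows "measure std_gaussian {w. u \<bullet> w \<in> {a1..b1} \<and> v \<bullet> w \<in> {a2..b2}}
       = strip_prob a1 b1 b2 (u \<bullet> v) - strip_prob a1 b1 a2 (u \<bullet> v)"
proof -
  define r where "r = u \<bullet> v"
  define s where "s = sqrt (1 - r\<^sup>2)"
  define w where "w = (v - r *\<^sub>R u) /\<^sub>R s"
  have "0 < 1 - r\<^sup>2"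
    using assms(4) abs_square_less_1[of r] by (simp add: r_def)
  then have s: "s > 0" "s\<^sup>2 = 1 - r\<^sup>2"
    by (simp_all add: s_def)
  have uu: "u \<bullet> u = 1" and vv: "v \<bullet> v = 1"
    using assms by (simp_all add: norm_eq_1)
  have "(v - r *\<^sub>R u) \<bullet> (v - r *\<^sub>R u) = s\<^sup>2"
    unfolding s(2) by (simp add: inner_diff_left inner_diff_right uu vv inner_commute[of v u] r_def[symmetric]
        power2_eq_square)
  then have "w \<bullet> w = 1"
    using s(1) unfolding w_def inner_scaleR_left inner_scaleR_right by (simp add: power2_eq_square field_simps)
  then have "norm w = 1"
    using norm_eq_1[of w] by blast
  have "u \<bullet> w = 0"
    by (simp add: w_def inner_diff_right uu r_def[symmetric])
  have v: "v = r *\<^sub>R u + s *\<^sub>R w"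
    using s by (simp add: w_def)
  let ?N = "std_normal_distribution"
  let ?X = "{p. fst p \<in> {a1..b1} \<and> r * fst p + s * snd p \<in> {a2..b2}}"
  let ?f = "\<lambda>x. \<Phi> ((b2 - r * x) / s) - \<Phi> ((a2 - r * x) / s)"
  have f: "?f x \<ge> 0" for x
    using s assms(5) by (simp add: \<Phi>_mono divide_right_mono)
  have "?X = {p \<in> space (borel \<Otimes>\<^sub>M borel). fst p \<in> {a1..b1} \<and> r * fst p + s * snd p \<in> {a2..b2}}"
    by (simp add: space_pair_measure)
  also have "\<dots> \<in> sets (borel \<Otimes>\<^sub>M borel)"
    by measurable
  finally have X: "?X \<in> sets (borel \<Otimes>\<^sub>M borel)" .
  have M: "(\<lambda>x. (u \<bullet> x, w \<bullet> x)) \<in> std_gaussian \<rightarrow>\<^sub>M borel \<Otimes>\<^sub>M borel"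
    by measurable
  have "(\<lambda>x. (u \<bullet> x, w \<bullet> x)) -` ?X \<inter> space std_gaussian = {x. u \<bullet> x \<in> {a1..b1} \<and> v \<bullet> x \<in> {a2..b2}}"
    by (subst v) (auto simp: inner_add_left)
  then have "emeasure std_gaussian {x. u \<bullet> x \<in> {a1..b1} \<and> v \<bullet> x \<in> {a2..b2}}
      = emeasure (distr std_gaussian (borel \<Otimes>\<^sub>M borel) (\<lambda>x. (u \<bullet> x, w \<bullet> x))) ?X"
    by (simp only: emeasure_distr[OF M X])
  also have "\<dots> = emeasure (?N \<Otimes>\<^sub>M ?N) ?X"
    using distr_std_gaussian_orthonormal[OF assms(1,2) \<open>norm w = 1\<close> \<open>u \<bullet> w = 0\<close>] by simp
  also have "\<dots> = (\<integral>\<^sup>+x. emeasure ?N (Pair x -` ?X) \<partial>?N)"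
    using X by (intro std_normal.emeasure_pair_measure_alt) (simp cong: sets_pair_measure_cong)
  also have "\<dots> = (\<integral>\<^sup>+x. indicator {a1..b1} x * ennreal (?f x) \<partial>?N)"
  proof (rule nn_integral_cong)
    fix x
    \<comment> \<open>Once the first coordinate is fixed at \<open>x\<close>, the second constraint
      confines Y to an interval, whose mass is a difference of two values of \<Phi>.\<close>
    have "Pair x -` ?X = (if x \<in> {a1..b1} then {(a2 - r * x) / s .. (b2 - r * x) / s} else {})"
      using s by (auto simp: field_simps)
    then show "emeasure ?N (Pair x -` ?X) = indicator {a1..b1} x * ennreal (?f x)"
      using s assms(5) by (simp add: \<Phi>_diff divide_right_mono std_normal.emeasure_eq_measure)
  qed
  also have "\<dots> = ennreal (integral {a1..b1} (\<lambda>x. std_normal_density x * ?f x))"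
    using s by (intro nn_integral_std_normal_Icc f continuous_intros) auto
  finally have "emeasure std_gaussian {x. u \<bullet> x \<in> {a1..b1} \<and> v \<bullet> x \<in> {a2..b2}}
      = ennreal (integral {a1..b1} (\<lambda>x. std_normal_density x * ?f x))" .
  \<comment> \<open>Continuity gives integrability and hence a nonnegative integral, needed to leave
    \<open>ennreal\<close>, which truncates negative reals to 0.\<close>
  moreover have "continuous_on {a1..b1} (\<lambda>x. std_normal_density x * ?f x)"
    using s(1) by (intro continuous_intros) auto
  then have "0 \<le> integral {a1..b1} (\<lambda>x. std_normal_density x * ?f x)"
    using f by (intro integral_nonneg integrable_continuous_interval) auto
  ultimately have "measure std_gaussian {x. u \<bullet> x \<in> {a1..b1} \<and> v \<bullet> x \<in> {a2..b2}}
      = integral {a1..b1} (\<lambda>x. std_normal_density x * ?f x)"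
    unfolding measure_def by (simp only: enn2real_ennreal)
  also have "\<dots> = integral {a1..b1} (\<lambda>x. std_normal_density x * \<Phi> ((b2 - r * x) / s) - std_normal_density x * \<Phi> ((a2 - r * x) / s))"
    by (simp only: right_diff_distrib)
  also have "\<dots> = strip_prob a1 b1 b2 r - strip_prob a1 b1 a2 r"
    using s(1) unfolding strip_prob_def s_def[symmetric]
    by (intro integral_diff integrable_continuous_interval continuous_intros) auto
  finally show ?thesis by (simp add: r_def)
qed

text \<open>Independence at correlation 0: the starting value of all monotonicity arguments in
  \<open>r\<close>.\<close>

lemma strip_prob_0: "strip_prob a b y 0 = measure std_normal_distribution {a..b} * \<Phi> y"
  unfolding strip_prob_def measure_std_normal_Icc integral_mult_left[symmetric] by simp

section \<open>Signs of the corner sums\<close>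

lemma binormal_density_eq:
  assumes "\<bar>r\<bar> < 1"
  shows "binormal_density r x y =
    exp (- (x\<^sup>2 - 2 * r * x * y + y\<^sup>2) / (2 * (1 - r\<^sup>2))) / (2 * pi * sqrt (1 - r\<^sup>2))"
proof -
  define s where "s = 1 - r\<^sup>2"
  have s: "s > 0"
    using assms abs_square_less_1[of r] by (simp add: s_def)
  \<comment> \<open>Completing the square read backwards: the factored exponent becomes the
    quadratic form symmetric in \<open>x\<close> and \<open>y\<close>.\<close>
  have "x\<^sup>2 * s + (y - r * x)\<^sup>2 = x\<^sup>2 - 2 * r * x * y + y\<^sup>2"
    by (simp add: s_def power2_eq_square algebra_simps)
  moreover have "- x\<^sup>2 / 2 + - ((y - r * x) / sqrt s)\<^sup>2 / 2 = - (x\<^sup>2 * s + (y - r * x)\<^sup>2) / (2 * s)"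
    unfolding power_divide real_sqrt_pow2[OF less_imp_le[OF s]] using s by (simp add: add_divide_distrib diff_divide_distrib)
  ultimately have "- x\<^sup>2 / 2 + - ((y - r * x) / sqrt s)\<^sup>2 / 2 = - (x\<^sup>2 - 2 * r * x * y + y\<^sup>2) / (2 * s)"
    by simp
  then have "exp (- x\<^sup>2 / 2) * exp (- ((y - r * x) / sqrt s)\<^sup>2 / 2) = exp (- (x\<^sup>2 - 2 * r * x * y + y\<^sup>2) / (2 * s))"
    by (metis exp_add)
  moreover have "binormal_density r x y
      = exp (- x\<^sup>2 / 2) * exp (- ((y - r * x) / sqrt s)\<^sup>2 / 2) / (sqrt (2 * pi) * sqrt (2 * pi) * sqrt s)"
    unfolding binormal_density_def std_normal_density_def s_def[symmetric] by simp
  moreover have "sqrt (2 * pi) * sqrt (2 * pi) = 2 * pi"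
    using pi_ge_zero by (intro real_sqrt_mult_self[THEN trans]) simp
  ultimately show ?thesis
    unfolding s_def[symmetric] by (simp only:)
qed

lemma binormal_density_minus [simp]:
  "binormal_density r (- x) (- y) = binormal_density r x y"
proof -
  have "(- y - r * - x) / sqrt (1 - r\<^sup>2) = - ((y - r * x) / sqrt (1 - r\<^sup>2))"
    by (simp add: minus_divide_left)
  then show ?thesis
    unfolding binormal_density_def by (simp add: std_normal_density_def)
qed

text \<open>The \<open>r\<close>-derivative of the probability of the rectangle with sides [a, b]
  and [a', b'], as \<open>DERIV_box_prob\<close> shows.\<close>

definition corner_sum :: "real \<Rightarrow> real \<Rightarrow> real \<Rightarrow> real \<Rightarrow> real \<Rightarrow> real" where
  "corner_sum a b a' b' r =
     binormal_density r b b' - binormal_density r a b' - binormal_density r b a' + binormal_density r a a'"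

text \<open>By central symmetry the sum is twice the density at (c, c) minus twice that at (-c, c),
  and a nonnegative correlation favours the corner with equal signs.\<close>

lemma corner_sum_null_null:
  assumes "0 \<le> r" "r < 1"
  shows "corner_sum (- c) c (- c) c r \<ge> 0"
proof -
  have "0 < 1 - r\<^sup>2"
    using assms abs_square_less_1[of r] by simp
  moreover have "- (c\<^sup>2 - 2 * r * - c * c + c\<^sup>2) \<le> - (c\<^sup>2 - 2 * r * c * c + c\<^sup>2)"
    using mult_nonneg_nonneg[OF assms(1) zero_le_square[of c]] by (simp add: mult.assoc)
  ultimately have "binormal_density r (- c) c \<le> binormal_density r c c"
    using assms by (simp add: binormal_density_eq divide_right_mono)
  moreover have "binormal_density r c (- c) = binormal_density r (- c) c"
    using binormal_density_minus[of r "- c" c] by simp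
  ultimately show ?thesis
    by (simp add: corner_sum_def)
qed

text \<open>
  With \<open>q = exp (- 2 k a)\<close> one has \<open>1 - exp (- 2 k b) \<le> 1 - q ^ 3 \<le> 3 (1 - q)\<close>, so the two
  differences of exponentials differ at most by the factor \<open>3 exp (k (b - a))\<close>.
\<close>
lemma exp_diff_ratio_le:
  fixes a b k :: real
  assumes "0 \<le> k" "0 \<le> a" "b \<le> 3 * a"
  shows "exp (k * b) - exp (- (k * b)) \<le> 3 * exp (k * (b - a)) * (exp (k * a) - exp (- (k * a)))"
proof -
  define q where "q = exp (- (2 * k * a))"
  have q: "0 < q" "q \<le> 1"
    using assms by (simp_all add: q_def)
  have "q ^ 3 = exp (- (6 * k * a))"
    by (simp add: q_def exp_of_nat_mult[symmetric] flip: exp_of_nat2_mult)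
  also have "\<dots> \<le> exp (- (2 * k * b))"
    using mult_left_mono[OF assms(3) assms(1)] by (simp add: mult_ac)
  finally have "1 - exp (- (2 * k * b)) \<le> 1 - q ^ 3"
    by simp
  also have "\<dots> = (1 - q) * (1 + q + q\<^sup>2)"
    by (simp add: algebra_simps power2_eq_square power3_eq_cube)
  also have "\<dots> \<le> (1 - q) * 3"
    using q power_le_one[of q 2] by (intro mult_left_mono) auto
  finally have "exp (k * b) * (1 - exp (- (2 * k * b))) \<le> exp (k * b) * (3 * (1 - q))"
    by (intro mult_left_mono) auto
  moreover have "exp (k * b) * (1 - exp (- (2 * k * b))) = exp (k * b) - exp (- (k * b))"
    by (simp add: right_diff_distrib flip: exp_add)
  moreover have "exp (k * b) * (3 * (1 - q)) = 3 * exp (k * (b - a)) * (exp (k * a) - exp (- (k * a)))"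
    by (simp add: q_def right_diff_distrib algebra_simps flip: exp_add)
  ultimately show ?thesis
    by simp
qed

text \<open>Central symmetry moves all corners to first coordinate \<open>c\<close>, where the claim
  compares the odd parts of the density at \<open>b\<close> and at \<open>a\<close>. These differ by
  at most a factor 3 and an exponential, which the Gaussian decay from \<open>a\<close> to
  \<open>b\<close> absorbs.\<close>

lemma corner_sum_null_false:
  assumes r: "0 \<le> r" "r < 1" and c: "0 < c" "ln 3 \<le> 2 * c\<^sup>2" and m: "2 * c \<le> m"
  shows "corner_sum (- c) c (- m - c) (- m + c) r \<le> 0"
proof -
  define a b s k where "a = m - c" and "b = m + c" and "s = 1 - r\<^sup>2" and "k = r * c / s"
  have s: "0 < s" "s \<le> 1"
    using r abs_square_less_1[of r] by (simp_all add: s_def)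
  have k: "k \<ge> 0"
    using r c s by (simp add: k_def)
  define K where "K = exp (- c\<^sup>2 / (2 * s)) / (2 * pi * sqrt s)"
  have K: "K > 0"
    using s by (simp add: K_def)
  \<comment> \<open>At fixed first coordinate \<open>c\<close> the cross term of the exponent is
    linear in \<open>x\<close>, with slope \<open>k\<close>.\<close>
  have dens: "binormal_density r c x = K * (exp (- x\<^sup>2 / (2 * s)) * exp (k * x))" for x
  proof -
    have "- (c\<^sup>2 - 2 * r * c * x + x\<^sup>2) / (2 * s) = - c\<^sup>2 / (2 * s) + (- x\<^sup>2 / (2 * s) + k * x)"
      using s by (simp add: k_def divide_simps)
    moreover have "\<bar>r\<bar> < 1"
      using r by simp
    ultimately show ?thesis
      unfolding binormal_density_eq[OF \<open>\<bar>r\<bar> < 1\<close>] K_def s_def[symmetric]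
      by (simp only: exp_add times_divide_eq_left)
  qed
  have "exp (- b\<^sup>2 / (2 * s)) * (exp (k * b) - exp (- (k * b)))
      \<le> exp (- b\<^sup>2 / (2 * s)) * (3 * exp (k * (b - a)) * (exp (k * a) - exp (- (k * a))))"
    using k m c by (intro mult_left_mono exp_diff_ratio_le) (auto simp: a_def b_def)
  also have "\<dots> = exp (ln 3 + k * (b - a) + - b\<^sup>2 / (2 * s)) * (exp (k * a) - exp (- (k * a)))"
  proof -
    have "exp (ln 3) = (3 :: real)"
      by simp
    then show ?thesis
      by (simp only: exp_add mult_ac)
  qed
  also have "\<dots> \<le> exp (- a\<^sup>2 / (2 * s)) * (exp (k * a) - exp (- (k * a)))"
  proof (rule mult_right_mono)
    \<comment> \<open>The balance of exponents: 2 m c is at least 4 c^2, the correlation costs at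
      most 2 c^2, and the remaining 2 c^2 pays for the factor 3.\<close>
    have "ln 3 * s \<le> ln 3"
      using s by (simp add: mult_left_le)
    moreover have "r * c\<^sup>2 \<le> c\<^sup>2"
      using r by (simp add: mult_left_le_one_le)
    moreover have "2 * c\<^sup>2 \<le> m * c"
      using mult_right_mono[OF m, of c] c by (simp add: power2_eq_square)
    ultimately have "ln 3 * s \<le> 2 * (m * c) - 2 * (r * c\<^sup>2)"
      using c(2) by linarith
    then have "ln 3 * s \<le> 2 * m * c - 2 * r * c\<^sup>2"
      by (simp only: mult.assoc)
    then have "ln 3 \<le> (2 * m * c - 2 * r * c\<^sup>2) / s"
      using s by (simp add: le_divide_eq)
    also have "\<dots> = (b\<^sup>2 - a\<^sup>2) / (2 * s) - k * (b - a)"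
      using s by (simp add: a_def b_def k_def power2_eq_square divide_simps) (simp add: algebra_simps)
    finally have "ln 3 + k * (b - a) - b\<^sup>2 / (2 * s) \<le> - a\<^sup>2 / (2 * s)"
      by (simp add: diff_divide_distrib)
    then show "exp (ln 3 + k * (b - a) + - b\<^sup>2 / (2 * s)) \<le> exp (- a\<^sup>2 / (2 * s))"
      by simp
    have "- (k * a) \<le> k * a"
      using k c m by (simp add: a_def)
    then show "0 \<le> exp (k * a) - exp (- (k * a))"
      by simp
  qed
  finally have "K * (exp (- b\<^sup>2 / (2 * s)) * (exp (k * b) - exp (- (k * b))))
      \<le> K * (exp (- a\<^sup>2 / (2 * s)) * (exp (k * a) - exp (- (k * a))))"
    using K by (intro mult_left_mono) auto
  then have "binormal_density r c b - binormal_density r c (- b) \<le> binormal_density r c a - binormal_density r c (- a)"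
    by (simp add: dens algebra_simps)
  moreover have "binormal_density r (- c) (- b) = binormal_density r c b"
      "binormal_density r (- c) (- a) = binormal_density r c a"
    by simp_all
  moreover have "- m - c = - b" "- m + c = - a"
    by (simp_all add: a_def b_def)
  ultimately show ?thesis
    unfolding corner_sum_def by simp
qed

text \<open>
  Divided by its largest term the corner sum is \<open>1 - p - q + p q exp (4 r c\<^sup>2 / (1 - r\<^sup>2))\<close>,
  where \<open>p \<le> 1\<close> and \<open>q \<le> 1\<close> are exactly the two bounds imposed on \<open>r\<close>.
\<close>
lemma corner_sum_false_false:
  assumes r: "0 \<le> r" "r < 1" and c: "0 < c" "c < m" "c < n"
    and rm: "r * (n - c) \<le> m" and rn: "r * (m - c) \<le> n"
  shows "corner_sum (- m - c) (- m + c) (- n - c) (- n + c) r > 0"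
proof -
  define s where "s = 1 - r\<^sup>2"
  have s: "0 < s"
    using r abs_square_less_1[of r] by (simp_all add: s_def)
  define p q e where "p = exp (- (2 * c * (m - r * (n - c)) / s))"
    and "q = exp (- (2 * c * (n - r * (m - c)) / s))" and "e = exp (4 * r * c\<^sup>2 / s)"
  define K where "K = binormal_density r (m - c) (n - c)"
  let ?Q = "\<lambda>x y. - (x\<^sup>2 - 2 * r * x * y + y\<^sup>2) / (2 * s)"
  have dens: "binormal_density r x y = exp (?Q x y) / (2 * pi * sqrt s)" for x y
    using r by (simp add: binormal_density_eq s_def)
  have K: "K > 0"
    using s by (simp add: K_def dens)
  have shift: "binormal_density r x y = K * exp d" if "?Q x y = ?Q (m - c) (n - c) + d" for x y d
    unfolding K_def dens that by (simp add: exp_add)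
  have 1: "binormal_density r (m + c) (n - c) = K * p"
    unfolding p_def using s by (intro shift) (simp add: divide_simps, simp add: power2_eq_square algebra_simps)
  have 2: "binormal_density r (m - c) (n + c) = K * q"
    unfolding q_def using s by (intro shift) (simp add: divide_simps, simp add: power2_eq_square algebra_simps)
  have 3: "binormal_density r (m + c) (n + c) = K * (p * q * e)"
    unfolding p_def q_def e_def exp_add[symmetric] using s
    by (intro shift) (simp add: divide_simps, simp add: power2_eq_square algebra_simps)
  have "corner_sum (- m - c) (- m + c) (- n - c) (- n + c) r
      = binormal_density r (m - c) (n - c) - binormal_density r (m + c) (n - c)
        - binormal_density r (m - c) (n + c) + binormal_density r (m + c) (n + c)"
    using binormal_density_minus[of r "m - c" "n - c"] binormal_density_minus[of r "m + c" "n - c"]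
      binormal_density_minus[of r "m - c" "n + c"] binormal_density_minus[of r "m + c" "n + c"]
    by (simp add: corner_sum_def)
  also have "\<dots> = K * ((1 - p) * (1 - q) + p * q * (e - 1))"
    unfolding 1 2 3 K_def[symmetric] by (simp add: algebra_simps)
  also have "\<dots> > 0"
  proof (rule mult_pos_pos[OF K])
    have le1: "p \<le> 1" "q \<le> 1"
      using c s rm rn by (simp_all add: p_def q_def)
    have pq: "p * q > 0"
      by (simp add: p_def q_def)
    show "0 < (1 - p) * (1 - q) + p * q * (e - 1)"
    \<comment> \<open>For positive \<open>r\<close> the bounds may be attained, so \<open>p\<close>
      or \<open>q\<close> may equal 1 and strictness comes from \<open>e > 1\<close>. At
      \<open>r = 0\<close> instead \<open>e = 1\<close>, while \<open>p\<close> and \<open>q\<close>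
      are below 1.\<close>
    proof (cases "r = 0")
      case True
      then have "p < 1" "q < 1"
        using c s by (simp_all add: p_def q_def)
      moreover have "e = 1"
        using True by (simp add: e_def)
      ultimately show ?thesis by simp
    next
      case False
      then have "e > 1"
        using r c s by (simp add: e_def)
      then have "p * q * (e - 1) > 0"
        using pq by simp
      then show ?thesis
        using le1 by (simp add: add_nonneg_pos)
    qed
  qed
  finally show ?thesis .
qed

section \<open>Covariances of Gaussian bands\<close>

lemma \<Phi>_nonneg: "0 \<le> \<Phi> x"
  unfolding \<Phi>_def by (rule std_normal.cdf_nonneg)

lemma \<Phi>_at_top: "(\<Phi> \<longlongrightarrow> 1) at_top"
  using std_normal.cdf_lim_at_top_prob by (simp add: \<Phi>_def[abs_def])

lemma \<Phi>_at_bot: "(\<Phi> \<longlongrightarrow> 0) at_bot"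
  using std_normal.cdf_lim_at_bot by (simp add: \<Phi>_def[abs_def])

text \<open>Evenness of the density makes \<open>\<Phi> x + \<Phi> (- x)\<close> constant, and its
  limit at infinity is 1.\<close>

lemma \<Phi>_0: "\<Phi> 0 = 1 / 2"
proof -
  have "((\<lambda>x. \<Phi> x + \<Phi> (- x)) has_real_derivative 0) (at x)" for x
  proof (rule DERIV_cong)
    show "((\<lambda>x. \<Phi> x + \<Phi> (- x)) has_real_derivative
        std_normal_density x * 1 + std_normal_density (- x) * (- 1)) (at x)"
      by (intro DERIV_add DERIV_\<Phi>_compose DERIV_minus DERIV_ident)
  qed (simp add: std_normal_density_def)
  then have const: "\<Phi> x + \<Phi> (- x) = \<Phi> 0 + \<Phi> (- 0)" for x
    using DERIV_isconst_all[of "\<lambda>x. \<Phi> x + \<Phi> (- x)" x 0] by blast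
  have "((\<lambda>x. \<Phi> x + \<Phi> (- x)) \<longlongrightarrow> 1 + 0) at_top"
    by (intro tendsto_add \<Phi>_at_top filterlim_compose[OF \<Phi>_at_bot] filterlim_uminus_at_bot_at_top)
  moreover have "(\<lambda>x. \<Phi> x + \<Phi> (- x)) = (\<lambda>_. \<Phi> 0 + \<Phi> (- 0))"
    by (rule ext) (rule const)
  ultimately have "((\<lambda>_. \<Phi> 0 + \<Phi> (- 0)) \<longlongrightarrow> 1 + 0) (at_top :: real filter)"
    by simp
  then have "\<Phi> 0 + \<Phi> (- 0) = 1 + 0"
    by (simp only: tendsto_const_iff[OF trivial_limit_at_top_linorder])
  then show ?thesis
    by simp
qed

lemma \<Phi>_quantile:
  assumes "0 < p" "p < 1"
  shows "\<Phi> (inv \<Phi> p) = p"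
proof (rule f_inv_into_f)
  obtain a where a: "\<Phi> a < p"
    using order_tendstoD(2)[OF \<Phi>_at_bot assms(1)] by (auto simp: eventually_at_bot_linorder)
  obtain b where b: "p < \<Phi> b"
    using order_tendstoD(1)[OF \<Phi>_at_top assms(2)] by (auto simp: eventually_at_top_linorder)
  have "a \<le> b"
    using \<Phi>_mono[of b a] a b by linarith
  moreover have "\<forall>x. a \<le> x \<and> x \<le> b \<longrightarrow> isCont \<Phi> x"
    using DERIV_\<Phi> DERIV_isCont by blast
  ultimately have "\<exists>x. a \<le> x \<and> x \<le> b \<and> \<Phi> x = p"
    using a b by (intro IVT) auto
  then show "p \<in> range \<Phi>"
    by auto
qed

section \<open>Bands: marginal law, sign symmetries and covariance\<close>

lemma measure_std_gaussian_inner: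
  fixes u :: "real ^ 'n::finite"
  assumes "norm u = 1" and ij: "(i::'n) \<noteq> j" and [measurable]: "A \<in> sets borel"
  shows "measure std_gaussian {w. u \<bullet> w \<in> A} = measure std_normal_distribution A"
proof -
  let ?T = "householder (u - axis i 1)"
  have T: "orthogonal_transformation ?T"
    by (rule orthogonal_transformation_householder)
  have Tu: "?T u = axis i 1"
    using assms(1) by (intro householder_swap) simp
  have inner: "u \<bullet> x = ?T x $ i" for x
  proof -
    have "u \<bullet> x = ?T u \<bullet> ?T x"
      using T by (simp add: orthogonal_transformation_def)
    then show ?thesis
      by (simp add: Tu inner_axis')
  qed
  have M: "?T \<in> std_gaussian \<rightarrow>\<^sub>M borel"
    unfolding measurable_cong_sets[OF sets_std_gaussian refl]
    by (rule borel_measurable_orthogonal_transformation[OF T])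
  have "{w \<in> space borel. w $ i \<in> A} \<in> sets (borel :: (real^'n) measure)"
    by measurable
  then have A: "{w. w $ i \<in> A} \<in> sets (borel :: (real^'n) measure)"
    by simp
  have "emeasure std_gaussian {w. u \<bullet> w \<in> A} = emeasure (distr std_gaussian borel ?T) {w. w $ i \<in> A}"
    by (subst emeasure_distr[OF M A]) (simp add: inner vimage_def)
  also have "\<dots> = emeasure std_gaussian {w :: real^'n. w $ i \<in> A}"
    by (simp only: distr_std_gaussian_orthogonal_transformation[OF T])
  \<comment> \<open>The single marginal is the formula for two coordinates with \<open>UNIV\<close>
    as the condition on \<open>j\<close>.\<close>
  also have "\<dots> = emeasure std_normal_distribution A"
    using emeasure_std_gaussian_coordinates[OF ij assms(3), of UNIV] std_normal.emeasure_space_1 by simp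
  finally show ?thesis
    by (simp add: measure_def)
qed

text \<open>Acceptance region of one test, pulled back to the standard Gaussian vector:
  \<open>m + u \<bullet> w\<close> plays the test statistic.\<close>

definition band :: "real \<Rightarrow> real \<Rightarrow> real ^ 'n::finite \<Rightarrow> (real ^ 'n) set" where
  "band c m u = {w. \<bar>m + u \<bullet> w\<bar> \<le> c}"

text \<open>Covariance of two acceptance indicators, which equals that of the rejection indicators
  since the two sign changes cancel.\<close>

definition band_cov :: "real \<Rightarrow> real \<Rightarrow> real \<Rightarrow> real ^ 'n::finite \<Rightarrow> real ^ 'n \<Rightarrow> real" where
  "band_cov c m n u v = measure std_gaussian (band c m u \<inter> band c n v)
     - measure std_gaussian (band c m u) * measure std_gaussian (band c n v)"

lemma band_eq: "band c m u = {w. u \<bullet> w \<in> {- m - c..- m + c}}"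
  by (auto simp: band_def abs_le_iff)

text \<open>Changing the sign of a test statistic leaves its band alone; this is what allows
  correlations and means to be taken nonnegative.\<close>

lemma band_minus: "band c (- m) (- u) = band c m u"
proof -
  have "- m + (- u) \<bullet> w = - (m + u \<bullet> w)" for w
    by simp
  then show ?thesis
    unfolding band_def by (simp only: abs_minus_cancel)
qed

lemma band_cov_minus_left: "band_cov c (- m) n (- u) v = band_cov c m n u v"
  by (simp add: band_cov_def band_minus)

lemma band_cov_minus_right: "band_cov c m (- n) u (- v) = band_cov c m n u v"
  by (simp add: band_cov_def band_minus)

lemma band_cov_commute: "band_cov c m n u v = band_cov c n m v u"
  by (simp add: band_cov_def Int_commute mult.commute)

definition box_prob :: "real \<Rightarrow> real \<Rightarrow> real \<Rightarrow> real \<Rightarrow> real \<Rightarrow> real" where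
  "box_prob a b a' b' r = strip_prob a b b' r - strip_prob a b a' r"

lemma DERIV_box_prob:
  assumes "a \<le> b" "\<bar>r\<bar> < 1"
  shows "(box_prob a b a' b' has_real_derivative corner_sum a b a' b' r) (at r)"
proof (rule DERIV_cong)
  show "(box_prob a b a' b' has_real_derivative
      (binormal_density r b b' - binormal_density r a b') - (binormal_density r b a' - binormal_density r a a')) (at r)"
    unfolding box_prob_def[abs_def] using assms by (intro DERIV_diff DERIV_strip_prob)
qed (simp add: corner_sum_def)

lemma norm_1_inner_le:
  fixes u v :: "'a::real_inner"
  assumes "norm u = 1" "norm v = 1"
  shows "u \<bullet> v \<le> 1" "u \<bullet> v = 1 \<Longrightarrow> u = v"
proof -
  show "u \<bullet> v \<le> 1"
    using norm_cauchy_schwarz[of u v] assms by simp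
  show "u = v" if "u \<bullet> v = 1"
    using norm_cauchy_schwarz_eq[of u v] assms that by simp
qed

lemma std_normal_density_le: "\<bar>x\<bar> \<le> \<bar>y\<bar> \<Longrightarrow> std_normal_density y \<le> std_normal_density x"
  by (simp add: std_normal_density_def divide_right_mono abs_le_square_iff)

text \<open>
  The case of correlation \<open>1\<close>: the interval on the right contains the half of the second interval
  nearer to \<open>0\<close>, hence at least half of its mass, while the first interval has mass below \<open>1 / 2\<close>.
\<close>
lemma coinciding_bands:
  assumes c: "0 < c" "c < m" and mn: "m \<le> n" "n - c \<le> m"
  shows "measure std_normal_distribution {- m - c..- m + c} * measure std_normal_distribution {- n - c..- n + c}
       < measure std_normal_distribution {- m - c..- n + c}"
proof -
  have pI: "measure std_normal_distribution {- m - c..- m + c} = \<Phi> (- m + c) - \<Phi> (- m - c)"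
    using c by (subst \<Phi>_diff[symmetric]) auto
  have pJ: "measure std_normal_distribution {- n - c..- n + c} = \<Phi> (- n + c) - \<Phi> (- n - c)"
    using c by (subst \<Phi>_diff[symmetric]) auto
  have pIJ: "measure std_normal_distribution {- m - c..- n + c} = \<Phi> (- n + c) - \<Phi> (- m - c)"
    using c mn by (subst \<Phi>_diff[symmetric]) auto
  \<comment> \<open>The window [x, x + c] gains mass as it moves towards the origin, so the near
    half of the second interval is at least as heavy as the far half.\<close>
  have "\<Phi> (- n - c + c) - \<Phi> (- n - c) \<le> \<Phi> (- n + c) - \<Phi> (- n)"
  proof (rule DERIV_nonneg_imp_nondecreasing[of "- n - c" "- n" "\<lambda>x. \<Phi> (x + c) - \<Phi> x"])
    fix x assume x: "- n - c \<le> x" "x \<le> - n"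
    have "((\<lambda>x. \<Phi> (x + c) - \<Phi> x) has_real_derivative
        std_normal_density (x + c) * (1 + 0) - std_normal_density x) (at x)"
      by (intro DERIV_diff DERIV_\<Phi>_compose DERIV_\<Phi> DERIV_add DERIV_ident DERIV_const)
    moreover have "std_normal_density x \<le> std_normal_density (x + c)"
      using x c mn by (intro std_normal_density_le) auto
    ultimately show "\<exists>y. ((\<lambda>x. \<Phi> (x + c) - \<Phi> x) has_real_derivative y) (at x) \<and> 0 \<le> y"
      by (intro exI[of _ "std_normal_density (x + c) * (1 + 0) - std_normal_density x"]) simp
  qed (use c in simp)
  moreover have "\<Phi> (- m - c) \<le> \<Phi> (- n)"
    using mn by (intro \<Phi>_mono) simp
  ultimately have half: "measure std_normal_distribution {- n - c..- n + c} / 2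
      \<le> measure std_normal_distribution {- m - c..- n + c}"
    unfolding pJ pIJ by simp
  have "\<Phi> (- m + c) < 1 / 2"
    using \<Phi>_strict_mono[of "- m + c" 0] c by (simp add: \<Phi>_0)
  then have "measure std_normal_distribution {- m - c..- m + c} < 1 / 2"
    unfolding pI using \<Phi>_nonneg[of "- m - c"] by linarith
  moreover have "0 < measure std_normal_distribution {- n - c..- n + c}"
    unfolding pJ using \<Phi>_strict_mono[of "- n - c" "- n + c"] c by simp
  ultimately have "measure std_normal_distribution {- m - c..- m + c} * measure std_normal_distribution {- n - c..- n + c}
      < 1 / 2 * measure std_normal_distribution {- n - c..- n + c}"
    by (rule mult_strict_right_mono)
  then show ?thesis
    using half by simp
qed

context
  fixes i j :: "'n::finite" and u v :: "real ^ 'n" and c :: real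
  assumes ij: "i \<noteq> j" and u: "norm u = 1" and v: "norm v = 1" and c: "c > 0"
begin

lemma measure_band:
  assumes "norm x = 1"
  shows "measure std_gaussian (band c m (x :: real ^ 'n)) = measure std_normal_distribution {- m - c..- m + c}"
  unfolding band_eq using assms ij by (intro measure_std_gaussian_inner) auto

text \<open>The covariance is the increment of the rectangle probability from correlation 0 to the
  actual one, so a sign of \<open>corner_sum\<close> along the way decides its sign.\<close>

lemma band_cov_eq:
  assumes "\<bar>u \<bullet> v\<bar> < 1"
  shows "band_cov c m n u v = box_prob (- m - c) (- m + c) (- n - c) (- n + c) (u \<bullet> v)
    - box_prob (- m - c) (- m + c) (- n - c) (- n + c) 0"
proof -
  have "measure std_gaussian (band c m u \<inter> band c n v) = box_prob (- m - c) (- m + c) (- n - c) (- n + c) (u \<bullet> v)"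
    unfolding band_eq box_prob_def using measure_std_gaussian_box[OF ij u v assms, of "- n - c" "- n + c"] c
    by (simp add: Int_def)
  moreover have "measure std_gaussian (band c m u) * measure std_gaussian (band c n v)
      = box_prob (- m - c) (- m + c) (- n - c) (- n + c) 0"
    unfolding measure_band[OF u] measure_band[OF v] box_prob_def strip_prob_0
    using \<Phi>_diff[of "- n - c" "- n + c"] c by (simp add: right_diff_distrib[symmetric])
  ultimately show ?thesis
    by (simp only: band_cov_def)
qed

lemma band_cov_same_direction:
  assumes "m \<le> n"
  shows "band_cov c m n u u = measure std_normal_distribution {- m - c..- n + c}
    - measure std_normal_distribution {- m - c..- m + c} * measure std_normal_distribution {- n - c..- n + c}"
proof -
  have "band c m u \<inter> band c n u = {w. u \<bullet> w \<in> {- m - c..- n + c}}"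
    unfolding band_eq using assms by auto
  then have "measure std_gaussian (band c m u \<inter> band c n u) = measure std_normal_distribution {- m - c..- n + c}"
    using u ij by (simp only: measure_std_gaussian_inner borel_closed closed_atLeastAtMost)
  then show ?thesis
    by (simp only: band_cov_def measure_band[OF u])
qed

lemma band_cov_null_null_nonneg_corr:
  assumes "0 \<le> u \<bullet> v"
  shows "band_cov c 0 0 u v \<ge> 0"
proof (cases "u \<bullet> v = 1")
  case True
  have "measure std_normal_distribution {- c..c} * measure std_normal_distribution {- c..c} \<le> measure std_normal_distribution {- c..c} * 1"
    using std_normal.prob_le_1 by (intro mult_left_mono) auto
  then show ?thesis
    using norm_1_inner_le(2)[OF u v True] band_cov_same_direction[of 0 0] by simp
next
  case False
  then have lt: "u \<bullet> v < 1"
    using norm_1_inner_le(1)[OF u v] by simp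
  have "box_prob (- c) c (- c) c 0 \<le> box_prob (- c) c (- c) c (u \<bullet> v)"
  proof (rule DERIV_nonneg_imp_nondecreasing[OF assms])
    fix r assume r: "0 \<le> r" "r \<le> u \<bullet> v"
    then show "\<exists>y. (box_prob (- c) c (- c) c has_real_derivative y) (at r) \<and> 0 \<le> y"
      using DERIV_box_prob[of "- c" c r "- c" c] corner_sum_null_null[of r c] lt c by force
  qed
  then show ?thesis
    using band_cov_eq[of 0 0] lt assms by simp
qed

lemma band_cov_null_false_nonneg_corr:
  assumes "0 \<le> u \<bullet> v" and "ln 3 \<le> 2 * c\<^sup>2" "2 * c \<le> m"
  shows "band_cov c 0 m u v \<le> 0"
proof (cases "u \<bullet> v = 1")
  case True
  \<comment> \<open>At correlation 1 the two bands meet in at most one point, as \<open>m\<close> is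
    at least \<open>2 * c\<close>; the joint probability is therefore 0.\<close>
  have "{- 0 - c..- m + c} \<subseteq> {- c}"
    using assms(3) by auto
  then have "measure std_normal_distribution {- 0 - c..- m + c} \<le> measure std_normal_distribution {- c}"
    by (intro std_normal.finite_measure_mono) auto
  then have "measure std_normal_distribution {- 0 - c..- m + c} \<le> 0"
    by (simp only: measure_std_normal_singleton)
  moreover have "band_cov c 0 m u v = measure std_normal_distribution {- 0 - c..- m + c}
      - measure std_normal_distribution {- 0 - c..- 0 + c} * measure std_normal_distribution {- m - c..- m + c}"
    using band_cov_same_direction[of 0 m] norm_1_inner_le(2)[OF u v True] assms(3) c by simp
  moreover have "0 \<le> measure std_normal_distribution {- 0 - c..- 0 + c} * measure std_normal_distribution {- m - c..- m + c}"
    by simp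
  ultimately show ?thesis
    by linarith
next
  case False
  then have lt: "u \<bullet> v < 1"
    using norm_1_inner_le(1)[OF u v] by simp
  have "box_prob (- c) c (- m - c) (- m + c) (u \<bullet> v) \<le> box_prob (- c) c (- m - c) (- m + c) 0"
  proof (rule DERIV_nonpos_imp_nonincreasing[OF assms(1)])
    fix r assume r: "0 \<le> r" "r \<le> u \<bullet> v"
    then show "\<exists>y. (box_prob (- c) c (- m - c) (- m + c) has_real_derivative y) (at r) \<and> y \<le> 0"
      using DERIV_box_prob[of "- c" c r "- m - c" "- m + c"] corner_sum_null_false[of r c m] lt c assms(2,3) by force
  qed
  then show ?thesis
    using band_cov_eq[of 0 m] lt assms(1) by simp
qed

lemma band_cov_false_false_pos_corr:
  assumes pos: "0 < u \<bullet> v" and mn: "c < m" "c < n"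
    and "u \<bullet> v * (n - c) \<le> m" "u \<bullet> v * (m - c) \<le> n"
  shows "band_cov c m n u v > 0"
proof (cases "u \<bullet> v = 1")
  case True
  then have "u = v"
    by (rule norm_1_inner_le(2)[OF u v])
  \<comment> \<open>At correlation 1 the assumed bounds read \<open>n - c \<le> m\<close> and
    \<open>m - c \<le> n\<close>. The interval estimate expects the smaller mean first, which
    symmetry of the covariance arranges.\<close>
  show ?thesis
  proof (cases "m \<le> n")
    case True
    then show ?thesis
      using band_cov_same_direction[of m n] coinciding_bands[of c m n] assms \<open>u \<bullet> v = 1\<close> c \<open>u = v\<close> by simp
  next
    case False
    then show ?thesis
      using band_cov_same_direction[of n m] coinciding_bands[of c n m] assms \<open>u \<bullet> v = 1\<close> c \<open>u = v\<close>
        band_cov_commute[of c m n u u] by simp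
  qed
next
  case False
  then have lt: "u \<bullet> v < 1"
    using norm_1_inner_le(1)[OF u v] by simp
  let ?P = "box_prob (- m - c) (- m + c) (- n - c) (- n + c)"
  have "?P 0 < ?P (u \<bullet> v)"
  proof (rule DERIV_pos_imp_increasing[OF pos])
    fix r assume r: "0 \<le> r" "r \<le> u \<bullet> v"
    \<comment> \<open>The bounds on the final correlation pass to every smaller \<open>r\<close>, so
      the corner sum is positive along the whole path.\<close>
    have "r * (n - c) \<le> u \<bullet> v * (n - c)" "r * (m - c) \<le> u \<bullet> v * (m - c)"
      using r mn by (auto intro!: mult_right_mono)
    then have "r * (n - c) \<le> m" "r * (m - c) \<le> n"
      using assms(4,5) by linarith+
    then have "corner_sum (- m - c) (- m + c) (- n - c) (- n + c) r > 0"
      using mn r lt c by (intro corner_sum_false_false) auto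
    moreover have "(?P has_real_derivative corner_sum (- m - c) (- m + c) (- n - c) (- n + c) r) (at r)"
      using r lt c by (intro DERIV_box_prob) auto
    ultimately show "\<exists>y. (?P has_real_derivative y) (at r) \<and> 0 < y"
      by blast
  qed
  then show ?thesis
    using band_cov_eq[of m n] lt pos by simp
qed

end

lemma band_cov_null_null:
  fixes u v :: "real ^ 'n::finite"
  assumes "(i::'n) \<noteq> j" "norm u = 1" "norm v = 1" "c > 0"
  shows "band_cov c 0 0 u v \<ge> 0"
proof (cases "0 \<le> u \<bullet> v")
  case True
  then show ?thesis
    using assms by (intro band_cov_null_null_nonneg_corr)
next
  case False
  then have "band_cov c 0 0 u (- v) \<ge> 0"
    using assms by (intro band_cov_null_null_nonneg_corr) auto
  then show ?thesis
    using band_cov_minus_right[of c 0 0 u v] by simp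
qed

text \<open>Flipping \<open>u\<close> repairs a negative correlation without touching the mean 0,
  and flipping \<open>v\<close> repairs a negative \<open>m\<close>.\<close>

lemma band_cov_null_false:
  fixes u v :: "real ^ 'n::finite"
  assumes "(i::'n) \<noteq> j" "norm u = 1" "norm v = 1" "c > 0" "ln 3 \<le> 2 * c\<^sup>2" "2 * c \<le> \<bar>m\<bar>"
  shows "band_cov c 0 m u v \<le> 0"
proof -
  have pos: "band_cov c 0 m u v \<le> 0" if "2 * c \<le> m" "norm v = 1" for m and v :: "real ^ 'n"
  proof (cases "0 \<le> u \<bullet> v")
    case True
    then show ?thesis
      using assms that by (intro band_cov_null_false_nonneg_corr)
  next
    case False
    then have "band_cov c 0 m (- u) v \<le> 0"
      using assms that by (intro band_cov_null_false_nonneg_corr) auto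
    then show ?thesis
      using band_cov_minus_left[of c 0 m u v] by simp
  qed
  show ?thesis
  proof (cases "0 \<le> m")
    case False
    then show ?thesis
      using pos[of "- m" "- v"] assms band_cov_minus_right[of c 0 m u v] by simp
  qed (use pos assms in simp)
qed

text \<open>Multiplying each direction by the sign of its mean makes both means positive; by the
  sign hypothesis the same flips make the correlation positive.\<close>

lemma band_cov_false_false:
  fixes u v :: "real ^ 'n::finite"
  assumes ij: "(i::'n) \<noteq> j" and uv: "norm u = 1" "norm v = 1" and c: "c > 0"
    and mn: "2 * c \<le> \<bar>m\<bar>" "2 * c \<le> \<bar>n\<bar>"
    and le: "\<bar>u \<bullet> v\<bar> \<le> min \<bar>m\<bar> \<bar>n\<bar> / (max \<bar>m\<bar> \<bar>n\<bar> - c)"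
    and sgn: "sgn (u \<bullet> v) = sgn (m * n)"
  shows "band_cov c m n u v > 0"
proof -
  define a b where "a = sgn m" and "b = sgn n"
  have ab: "a = 1 \<or> a = - 1" "b = 1 \<or> b = - 1" and mab: "a * m = \<bar>m\<bar>" "b * n = \<bar>n\<bar>"
    using mn c by (auto simp: a_def b_def sgn_if)
  have eq: "band_cov c (a * m) (b * n) (a *\<^sub>R u) (b *\<^sub>R v) = band_cov c m n u v"
    using ab by (elim disjE) (simp_all add: band_cov_minus_left band_cov_minus_right)
  have "sgn (u \<bullet> v) = a * b"
    using sgn by (simp add: a_def b_def sgn_mult)
  then have inner: "(a *\<^sub>R u) \<bullet> (b *\<^sub>R v) = \<bar>u \<bullet> v\<bar>"
    using ab by (auto simp: abs_sgn mult.commute)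
  have "sgn (u \<bullet> v) \<noteq> 0"
    using \<open>sgn (u \<bullet> v) = a * b\<close> ab by auto
  then have pos: "0 < \<bar>u \<bullet> v\<bar>"
    by (auto simp: sgn_if split: if_splits)
  have "\<bar>u \<bullet> v\<bar> * (max \<bar>m\<bar> \<bar>n\<bar> - c) \<le> min \<bar>m\<bar> \<bar>n\<bar>"
    using le mn c by (subst (asm) pos_le_divide_eq) auto
  moreover have "\<bar>u \<bullet> v\<bar> * (\<bar>m\<bar> - c) \<le> \<bar>u \<bullet> v\<bar> * (max \<bar>m\<bar> \<bar>n\<bar> - c)"
      "\<bar>u \<bullet> v\<bar> * (\<bar>n\<bar> - c) \<le> \<bar>u \<bullet> v\<bar> * (max \<bar>m\<bar> \<bar>n\<bar> - c)"
    by (auto intro!: mult_left_mono)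
  ultimately have "\<bar>u \<bullet> v\<bar> * (\<bar>n\<bar> - c) \<le> \<bar>m\<bar>" "\<bar>u \<bullet> v\<bar> * (\<bar>m\<bar> - c) \<le> \<bar>n\<bar>"
    by linarith+
  moreover have "norm (a *\<^sub>R u) = 1" "norm (b *\<^sub>R v) = 1"
    using uv ab by auto
  moreover have "c < \<bar>m\<bar>" "c < \<bar>n\<bar>"
    using mn c by linarith+
  ultimately have "band_cov c \<bar>m\<bar> \<bar>n\<bar> (a *\<^sub>R u) (b *\<^sub>R v) > 0"
    using pos by (intro band_cov_false_false_pos_corr[OF ij _ _ c]) (simp_all only: inner)
  then show ?thesis
    using eq by (simp add: mab)
qed

section \<open>From covariances of tests to covariances of bands\<close>

lemma (in prob_space) covariance_complement_indicators:
  assumes [measurable]: "A \<in> events" "B \<in> events"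
    and f: "\<And>\<omega>. \<omega> \<in> space M \<Longrightarrow> f \<omega> = 1 - indicator A \<omega>"
    and g: "\<And>\<omega>. \<omega> \<in> space M \<Longrightarrow> g \<omega> = 1 - indicator B \<omega>"
  shows "covariance M f g = prob (A \<inter> B) - prob A * prob B"
proof -
  have [simp]: "integrable M (indicator S :: 'a \<Rightarrow> real)" if "S \<in> events" for S
    using that by (simp add: integrable_indicator_iff less_top[symmetric])
  have Ef: "(LINT \<omega>|M. f \<omega>) = 1 - prob A"
    using f by (subst Bochner_Integration.integral_cong[OF refl f]) (auto simp: prob_space)
  have Eg: "(LINT \<omega>|M. g \<omega>) = 1 - prob B"
    using g by (subst Bochner_Integration.integral_cong[OF refl g]) (auto simp: prob_space)
  have "covariance M f g
      = (LINT \<omega>|M. indicator (A \<inter> B) \<omega> - prob B * indicator A \<omega> - prob A * indicator B \<omega> + prob A * prob B)"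
    unfolding covariance_def Ef Eg
    by (intro Bochner_Integration.integral_cong refl) (auto simp: f g indicator_def algebra_simps)
  also have "\<dots> = prob (A \<inter> B) - prob A * prob B"
    by (simp add: prob_space)
  finally show ?thesis .
qed

text \<open>Only the law of \<open>Z\<close> matters, and coordinate \<open>k\<close> of
  \<open>\<mu> + A *v w\<close> is \<open>\<mu> $ k\<close> plus the inner product of row
  \<open>k\<close> of \<open>A\<close> with \<open>w\<close>. Non-rejection is thus a band in the
  direction of that row.\<close>

lemma covariance_test_eq_band_cov:
  fixes Z :: "'a \<Rightarrow> real ^ 'n::finite"
  assumes "prob_space M" and Z[measurable]: "Z \<in> borel_measurable M"
    and distr: "distr M borel Z = distr std_gaussian borel (\<lambda>w. \<mu> + A *v w)"
  shows "covariance M (test t Z i) (test t Z j) = band_cov \<bar>quantile_half t\<bar> (\<mu> $ i) (\<mu> $ j) (A $ i) (A $ j)"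
proof -
  interpret prob_space M by fact
  let ?c = "\<bar>quantile_half t\<bar>"
  let ?S = "\<lambda>k. {z :: real ^ 'n. \<bar>z $ k\<bar> \<le> ?c}"
  have "closed (?S k)" for k
    by (intro closed_Collect_le continuous_intros)
  then have S: "?S k \<in> sets borel" for k
    by (rule borel_closed)
  have "(\<lambda>w. \<mu> + A *v w) \<in> borel_measurable borel"
    by (intro borel_measurable_continuous_onI continuous_intros linear_continuous_on)
      (simp add: linear_conv_bounded_linear[symmetric] matrix_vector_mul_linear)
  then have G: "(\<lambda>w. \<mu> + A *v w) \<in> std_gaussian \<rightarrow>\<^sub>M borel"
    by (simp cong: measurable_cong_sets)
  have push: "prob (Z -` T \<inter> space M) = measure std_gaussian ((\<lambda>w. \<mu> + A *v w) -` T)" if "T \<in> sets borel" for T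
    using measure_distr[OF Z that] measure_distr[OF G that] by (simp add: distr)
  have pull: "(\<lambda>w. \<mu> + A *v w) -` ?S k = band ?c (\<mu> $ k) (A $ k)" for k
    by (auto simp: band_def matrix_vector_mul_component)
  let ?B = "\<lambda>k. Z -` ?S k \<inter> space M"
  have "covariance M (test t Z i) (test t Z j) = prob (?B i \<inter> ?B j) - prob (?B i) * prob (?B j)"
    using S by (intro covariance_complement_indicators measurable_sets[OF Z])
      (auto simp: test_def indicator_def)
  also have "?B i \<inter> ?B j = Z -` (?S i \<inter> ?S j) \<inter> space M"
    by blast
  also have "prob \<dots> = measure std_gaussian (band ?c (\<mu> $ i) (A $ i) \<inter> band ?c (\<mu> $ j) (A $ j))"
    using S by (subst push) (auto simp only: vimage_Int pull)
  finally show ?thesis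
    by (simp only: push[OF S] pull band_cov_def)
qed

section \<open>Sign of the quantile and assembly of the three sums\<close>

lemma quantile_half_neg:
  assumes "0 < t" "t < 1"
  shows "quantile_half t < 0"
proof (rule ccontr)
  assume "\<not> quantile_half t < 0"
  then have "1 / 2 \<le> \<Phi> (quantile_half t)"
    using \<Phi>_mono[of 0 "quantile_half t"] by (simp add: \<Phi>_0)
  then show False
    using \<Phi>_quantile[of "t / 2"] assms by (simp add: quantile_half_def)
qed

lemma \<xi>_bar_nonneg: "0 \<le> \<xi>_bar t \<mu>"
  unfolding \<xi>_bar_def \<xi>_def by (intro mult_nonneg_nonneg sum_nonneg add_nonneg_nonneg \<Phi>_nonneg) auto

theorem theorem3:
  fixes M :: "'a measure"
    and Z :: "'a \<Rightarrow> real ^ 'n::{finite,linorder}"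
    and \<mu> :: "real ^ 'n::{finite,linorder}"
    and \<Sigma> :: "real ^ 'n::{finite,linorder} ^ 'n::{finite,linorder}"
    and t :: real
  assumes "prob_space M"
    and "0 < t" and "t < 1"
    and "multivariate_normal M Z \<mu> \<Sigma>"
    and "\<And>j. \<Sigma> $ j $ j = 1"
    and "card (true_nulls \<mu>) \<ge> 1"
    and "card (false_nulls \<mu>) \<ge> 2"
    and "\<And>i j. i \<in> false_nulls \<mu> \<Longrightarrow> j \<in> false_nulls \<mu> \<Longrightarrow> i \<noteq> j \<Longrightarrow>
           \<bar>\<mu> $ i\<bar> \<ge> 2 * \<bar>quantile_half t\<bar> \<and> 2 * \<bar>quantile_half t\<bar> > 2 * sqrt (ln 3 / 2)"
    and "\<And>i j. i \<in> false_nulls \<mu> \<Longrightarrow> j \<in> false_nulls \<mu> \<Longrightarrow> i \<noteq> j \<Longrightarrow>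
           \<bar>\<Sigma> $ i $ j\<bar> \<le> min \<bar>\<mu> $ i\<bar> \<bar>\<mu> $ j\<bar> / (max \<bar>\<mu> $ i\<bar> \<bar>\<mu> $ j\<bar> + quantile_half t)"
    and "\<And>i j. i \<in> false_nulls \<mu> \<Longrightarrow> j \<in> false_nulls \<mu> \<Longrightarrow> i \<noteq> j \<Longrightarrow>
           sgn (\<Sigma> $ i $ j) = sgn (\<mu> $ i * \<mu> $ j)"
  shows "V2 M Z \<mu> t > 0"
proof -
  obtain A :: "real ^ 'n::{finite,linorder} ^ 'n::{finite,linorder}" where Z: "Z \<in> borel_measurable M" and A: "A ** transpose A = \<Sigma>"
    and distr: "distr M borel Z = distr std_gaussian borel (\<lambda>w. \<mu> + A *v w)"
    using assms(4) unfolding multivariate_normal_def by blast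
  define c where "c = \<bar>quantile_half t\<bar>"
  have q: "quantile_half t = - c" and c: "c > 0"
    using quantile_half_neg[OF assms(2,3)] by (simp_all add: c_def)
  define C where "C i j = covariance M (test t Z i) (test t Z j)" for i j
  have C: "C i j = band_cov c (\<mu> $ i) (\<mu> $ j) (A $ i) (A $ j)" for i j
    unfolding C_def c_def by (rule covariance_test_eq_band_cov[OF assms(1) Z distr])
  \<comment> \<open>The rows of \<open>A\<close> have Gram matrix \<open>\<Sigma>\<close>: the unit
    diagonal makes them unit vectors and the other entries are their correlations.\<close>
  have inner: "A $ i \<bullet> A $ j = \<Sigma> $ i $ j" for i j
    unfolding A[symmetric] by (simp add: matrix_matrix_mult_def transpose_def inner_vec_def)
  have unit: "norm (A $ i) = 1" for i
    by (simp add: norm_eq_1 inner assms(5))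

  \<comment> \<open>This pair serves three times: as two distinct coordinates for the band lemmas,
    as a supply of partners in the pairwise hypotheses, and as a term that makes the last sum
    positive.\<close>
  obtain k l where kl: "k \<in> false_nulls \<mu>" "l \<in> false_nulls \<mu>" "k \<noteq> l"
    using assms(7) by (metis card_2_iff' obtain_subset_with_card_n subsetD)
  have big: "2 * c \<le> \<bar>\<mu> $ i\<bar>" if "i \<in> false_nulls \<mu>" for i
    using assms(8)[OF that, of k] assms(8)[OF that, of l] kl by (auto simp: c_def)
  have "sqrt (ln 3 / 2) \<le> c"
    using assms(8)[OF kl] by (simp add: c_def)
  then have "(sqrt (ln 3 / 2))\<^sup>2 \<le> c\<^sup>2"
    by (intro power_mono) auto
  then have ln3: "ln 3 \<le> 2 * c\<^sup>2"
    by simp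

  have null_null: "0 \<le> C i j" if "i \<in> true_nulls \<mu>" "j \<in> true_nulls \<mu>" for i j
    using that band_cov_null_null[OF kl(3) unit unit c] by (simp add: C true_nulls_def)
  have null_false: "C i j \<le> 0" if "i \<in> true_nulls \<mu>" "j \<in> false_nulls \<mu>" for i j
    using that band_cov_null_false[OF kl(3) unit unit c ln3 big] by (simp add: C true_nulls_def)
  have false_false: "0 < C i j" if "i \<in> false_nulls \<mu>" "j \<in> false_nulls \<mu>" "i \<noteq> j" for i j
    unfolding C using assms(9,10)[OF that]
    by (intro band_cov_false_false[OF kl(3) unit unit c big[OF that(1)] big[OF that(2)]]) (simp_all add: inner q)

  define p0 p1 x where "p0 = real (card (true_nulls \<mu>))" and "p1 = real (card (false_nulls \<mu>))"
    and "x = \<xi>_bar t \<mu>"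
  have pos: "0 < p0" "0 < p1" "0 \<le> x" "0 < t"
    using assms(2,6,7) \<xi>_bar_nonneg by (simp_all add: p0_def p1_def x_def)
  \<comment> \<open>Positivity comes from \<open>p0 * t\<close> alone, so nonnegativity of
    \<open>x\<close> is enough.\<close>
  then have D: "0 < (p0 * t + p1 * x) ^ 4"
    by (intro zero_less_power add_pos_nonneg mult_pos_pos mult_nonneg_nonneg) auto
  let ?FF = "{(i, j). i < j \<and> i \<in> false_nulls \<mu> \<and> j \<in> false_nulls \<mu>}"
  have "0 \<le> 2 * p1\<^sup>2 * x\<^sup>2 / (p0 * t + p1 * x) ^ 4 *
      (\<Sum>(i, j)\<in>{(i, j). i < j \<and> i \<in> true_nulls \<mu> \<and> j \<in> true_nulls \<mu>}. C i j)"
    using D null_null by (intro mult_nonneg_nonneg sum_nonneg) auto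
  moreover have "2 * p0 * p1 * t * x / (p0 * t + p1 * x) ^ 4 *
      (\<Sum>(i, j)\<in>true_nulls \<mu> \<times> false_nulls \<mu>. C i j) \<le> 0"
    using D pos null_false by (intro mult_nonneg_nonpos sum_nonpos) auto
  moreover have "0 < 2 * p0\<^sup>2 * t\<^sup>2 / (p0 * t + p1 * x) ^ 4 * (\<Sum>(i, j)\<in>?FF. C i j)"
  proof (rule mult_pos_pos)
    have "(min k l, max k l) \<in> ?FF"
      using kl by (auto simp: min_def max_def)
    then show "0 < (\<Sum>(i, j)\<in>?FF. C i j)"
      using false_false by (intro sum_pos) auto
    show "0 < 2 * p0\<^sup>2 * t\<^sup>2 / (p0 * t + p1 * x) ^ 4"
      using D pos by simp
  qed
  ultimately show ?thesis
    unfolding V2_def Let_def p0_def[symmetric] p1_def[symmetric] x_def[symmetric] C_def[symmetric]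
    by linarith
qed

end
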